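(* Let $\Sigma,\Gamma$ be two finite weighted subsets of $\mathbf{N}^*$, and let $s,t$ be two positive integers. Then $$\zeta_A\begin{pmatrix}\Sigma\\ s\end{pmatrix}\zeta_A\begin{pmatrix}\Gamma\\ t\end{pmatrix}=\zeta_A\begin{pmatrix}\Sigma&\Gamma\\ s&t\end{pmatrix}+\zeta_A\begin{pmatrix}\Gamma&\Sigma\\ t&s\end{pmatrix}+\zeta_A\begin{pmatrix}\Sigma\sqcup\Gamma\\ s+t\end{pmatrix}+\sum_{\substack{J\subseteq\Gamma;\ I\sqcup J=\Sigma\sqcup\Gamma\\ i+j=s+t}}\Delta^{\Gamma,j}_{J,t}\,\zeta_A\begin{pmatrix}I&J\\ i&j\end{pmatrix}+\sum_{\substack{J\subseteq\Sigma;\ I\sqcup J=\Sigma\sqcup\Gamma\\ i+j=s+t}}\Delta^{\Sigma,j}_{J,s}\,\zeta_A\begin{pmatrix}I&J\\ i&j\end{pmatrix},$$ where the indices $i,j$ run through all positive integers (and $I,J$ through finite weighted subsets of $\mathbf{N}^*$) satisfying the indicated conditions.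
   Context: $\mathbf{N}$ is the set of non-negative integers, $\mathbf{N}^*$ the positive integers, $\mathbf{F}_q$ a finite field with $q$ elements, $A=\mathbf{F}_q[\theta]$, $A^+$ the set of monic polynomials in $A$, $K_\infty=\mathbf{F}_q((1/\theta))$, $\mathbf{C}_\infty$ the completion of an algebraic closure of $K_\infty$, and $(t_n)_{n\in\mathbf{N}^*}$ independent indeterminates. A finite weighted subset of $\mathbf{N}^*$ is a family $\Sigma=\{\sigma_n\}_{n\in\mathbf{N}^*}$ of elements of $\mathbf{N}$ with $\sigma_n=0$ for all but finitely many $n$; its cardinality is $|\Sigma|=\sum_n\sigma_n$ and its support is $\{n:\sigma_n\neq0\}$. $J=\{j_n\}\subseteq\Sigma$ means $j_n\le\sigma_n$ for all $n$; $\Sigma\sqcup\Gamma=\{\sigma_n+\gamma_n\}_n$; $\binom{\Sigma}{J}=\prod_n\binom{\sigma_n}{j_n}$ for $J\subseteq\Sigma$. For $a\in A$, $\chi_\Sigma(a)=\prod_n a(t_n)^{\sigma_n}$, where $a(t_n)$ is obtained by replacing $\theta$ with $t_n$. For finite weighted subsets $\Sigma_1,\dots,\Sigma_r$ and positive integers $s_1,\dots,s_r$, $$\zeta_A\begin{pmatrix}\Sigma_1&\cdots&\Sigma_r\\ s_1&\cdots&s_r\end{pmatrix}=\sum_{\substack{a_i\in A^+\\ \deg a_1>\cdots>\deg a_r\ge0}}\frac{\chi_{\Sigma_1}(a_1)\cdots\chi_{\Sigma_r}(a_r)}{a_1^{s_1}\cdots a_r^{s_r}},$$ an element of the Tate algebra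 over $\mathbf{C}_\infty$ (completion of the polynomial ring for the Gauss valuation) in the $t_n$ with $n$ in the support of $\Sigma_1\sqcup\cdots\sqcup\Sigma_r$. For $J\subseteq\Sigma$ and positive integers $j,s$, set $\Delta^{\Sigma,j}_{J,s}=(-1)^{|J|+s-1}\binom{\Sigma}{J}\binom{j-1}{s-1}$ if $|J|\equiv j\pmod{q-1}$, and $\Delta^{\Sigma,j}_{J,s}=0$ otherwise. *)

theory Defs
  imports
    "HOL-Analysis.Analysis"
    "HOL-Computational_Algebra.Formal_Laurent_Series"
    "HOL-Number_Theory.Cong"
    "HOL-Library.Multiset"
begin

section \<open>Non-archimedean valued fields and the field of complex numbers at infinity\<close>

text \<open>Fields with a multiplicative absolute value satisfying the ultrametric inequality.
  Positivity and definiteness of the absolute value come from \<^class>\<open>metric_space\<close>.  (The norm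
  of the library is not used, since its classes are restricted to real vector spaces.)\<close>

class nonarch_field = field + metric_space +
  fixes absv :: "'a \<Rightarrow> real"
  assumes dist_absv: "dist x y = absv (x - y)"
    and absv_mult: "absv (x * y) = absv x * absv y"
    and absv_add: "absv (x + y) \<le> max (absv x) (absv y)"

text \<open>\<open>'a\<close> is the finite field with \<open>q = CARD('a)\<close> elements, and \<open>'a fls\<close> is
  \<open>K\<^sub>\<infinity> = F\<^sub>q((1/\<theta>))\<close>, with \<^const>\<open>fls_X\<close> in the role of \<open>1/\<theta>\<close> and \<^const>\<open>fls_X_inv\<close> in the
  role of \<open>\<theta>\<close>.  The absolute value is the one with \<open>|\<theta>| = q\<close>.\<close>

definition Kinf_norm :: "'a::{finite,field} fls \<Rightarrow> real" where
  "Kinf_norm x = (if x = 0 then 0 else real CARD('a) powi (- fls_subdegree x))"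

definition algebraic_over :: "('a::field fls \<Rightarrow> 'c::field) \<Rightarrow> 'c \<Rightarrow> bool" where
  "algebraic_over \<iota> x \<longleftrightarrow> (\<exists>p. p \<noteq> 0 \<and> poly (map_poly \<iota> p) x = 0)"

text \<open>A complete valued field \<open>'c\<close> together with \<open>\<iota> : K\<^sub>\<infinity> \<rightarrow> 'c\<close> is a completion of an algebraic
  closure of \<open>K\<^sub>\<infinity>\<close>: the map \<open>\<iota>\<close> is an isometric embedding of fields, the elements of \<open>'c\<close> that are
  algebraic over \<open>K\<^sub>\<infinity>\<close> form an algebraically closed field, and they are dense.  This determines
  \<open>'c\<close> up to isometric isomorphism over \<open>K\<^sub>\<infinity>\<close>.\<close>

locale C_infty =
  fixes \<iota> :: "'a::{finite,field} fls \<Rightarrow> 'c::{nonarch_field,complete_space}"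
  assumes hom_one: "\<iota> 1 = 1"
    and hom_add: "\<iota> (x + y) = \<iota> x + \<iota> y"
    and hom_mult: "\<iota> (x * y) = \<iota> x * \<iota> y"
    and norm_hom: "absv (\<iota> x) = Kinf_norm x"
    and alg_closed: "\<lbrakk>\<And>i. algebraic_over \<iota> (coeff p i); degree p > 0\<rbrakk>
      \<Longrightarrow> \<exists>x. algebraic_over \<iota> x \<and> poly p x = 0"
    and alg_dense: "closure {x. algebraic_over \<iota> x} = UNIV"

lemma absv_zero [simp]: "absv (0::'c::nonarch_field) = 0"
  using dist_absv[of "0::'c" 0] by simp

lemma absv_eq_zero [simp]: "absv (x::'c::nonarch_field) = 0 \<longleftrightarrow> x = 0"
  using dist_absv[of x 0] by (metis diff_zero dist_eq_0_iff)

lemma absv_nonneg [simp]: "0 \<le> absv (x::'c::nonarch_field)"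
  using dist_absv[of x 0] by (metis diff_zero zero_le_dist)

lemma absv_one [simp]: "absv (1::'c::nonarch_field) = 1"
  using absv_mult[of "1::'c" 1] by simp

lemma absv_minus [simp]: "absv (- x::'c::nonarch_field) = absv x"
proof -
  have "absv (-1::'c) * absv (-1::'c) = 1"
    using absv_mult[of "-1::'c" "-1"] by simp
  then have "absv (-1::'c) = 1"
    by (metis absv_nonneg real_sqrt_abs2 real_sqrt_one abs_of_nonneg)
  then show ?thesis
    using absv_mult[of "-1" x] by simp
qed

lemma absv_diff: "absv (x - y::'c::nonarch_field) \<le> max (absv x) (absv y)"
  using absv_add[of x "- y"] by simp

lemma absv_sum:
  fixes f :: "'b \<Rightarrow> 'c::nonarch_field"
  assumes "finite S" "0 \<le> B" "\<And>x. x \<in> S \<Longrightarrow> absv (f x) \<le> B"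
  shows "absv (sum f S) \<le> B"
  using assms
proof (induction rule: finite_induct)
  case (insert x F)
  then show ?case
    using absv_add[of "f x" "sum f F"] by fastforce
qed auto


section \<open>The Tate algebra\<close>

text \<open>A multiset \<open>M\<close> of indices encodes the monomial \<open>\<Prod>\<^sub>n t\<^sub>n ^ count M n\<close>, so that an element is a
  power series in the variables \<open>t\<^sub>n\<close> whose coefficients tend to zero.  All the variables \<open>t\<^sub>n\<close> are
  put in one ring; the Tate algebra in the variables \<open>t\<^sub>n\<close>, \<open>n \<in> S\<close>, is the closed subring
  \<open>tate_in S\<close> below.  That these are the completions of the polynomial rings for the Gauss norm is
  the content of the instance of \<^class>\<open>complete_space\<close> and of the lemmas \<open>closed_tate_in\<close> and
  \<open>tate_in_eq_closure\<close>.\<close>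

typedef (overloaded) 'c tate =
  "{f :: nat multiset \<Rightarrow> 'c::nonarch_field. \<forall>e>0. finite {M. e \<le> absv (f M)}}"
  morphisms tate_coeff Abs_tate
proof
  have "{M::nat multiset. e \<le> absv (0::'c)} = {}" if "e > 0" for e :: real
    using that by auto
  then show "(\<lambda>_. 0) \<in> {f :: nat multiset \<Rightarrow> 'c. \<forall>e>0. finite {M. e \<le> absv (f M)}}"
    by simp
qed

setup_lifting type_definition_tate

lemma tate_eqI: "(\<And>M. tate_coeff f M = tate_coeff g M) \<Longrightarrow> f = g"
  by (metis ext tate_coeff_inject)

lemma finite_tate_coeff: "e > 0 \<Longrightarrow> finite {M. e \<le> absv (tate_coeff f M)}"
  using tate_coeff[of f] by auto

lemma null_family_bounded:
  fixes f :: "nat multiset \<Rightarrow> 'c::nonarch_field"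
  assumes "\<And>e. e > 0 \<Longrightarrow> finite {M. e \<le> absv (f M)}"
  obtains B where "B > 0" "\<And>M. absv (f M) \<le> B"
proof -
  define T where "T = insert 1 ((\<lambda>M. absv (f M)) ` {M. 1 \<le> absv (f M)})"
  have T: "finite T"
    using assms unfolding T_def by simp
  have "absv (f M) \<le> Max T" for M
  proof (cases "1 \<le> absv (f M)")
    case True
    then show ?thesis
      using T by (intro Max_ge) (auto simp: T_def)
  next
    case False
    moreover have "1 \<le> Max T"
      using T by (intro Max_ge) (auto simp: T_def)
    ultimately show ?thesis by linarith
  qed
  moreover have "1 \<le> Max T"
    using T by (intro Max_ge) (auto simp: T_def)
  ultimately show ?thesis
    using that[of "Max T"] by fastforce
qed

lemma finite_splits: "finite {(A, B). A + B = (M::'b multiset)}"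
proof -
  have "finite {A. A \<subseteq># M}"
  proof (induction M)
    case (add x M)
    have "{A. A \<subseteq># add_mset x M} \<subseteq> {A. A \<subseteq># M} \<union> add_mset x ` {A. A \<subseteq># M}"
    proof
      fix A assume A: "A \<in> {A. A \<subseteq># add_mset x M}"
      show "A \<in> {A. A \<subseteq># M} \<union> add_mset x ` {A. A \<subseteq># M}"
      proof (cases "x \<in># A")
        case True
        then obtain A' where "A = add_mset x A'"
          by (metis insert_DiffM)
        then show ?thesis using A by auto
      next
        case False
        then show ?thesis using A
          by (metis CollectD CollectI UnI1 diff_single_trivial subset_eq_diff_conv
              add_mset_add_single)
      qed
    qed
    then show ?case
      using add finite_subset by blast
  qed auto
  then have "finite ({A. A \<subseteq># M} \<times> {A. A \<subseteq># M})" by blast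
  moreover have "{(A, B). A + B = M} \<subseteq> {A. A \<subseteq># M} \<times> {A. A \<subseteq># M}"
    by auto
  ultimately show ?thesis by (rule finite_subset[rotated])
qed

instantiation tate :: (nonarch_field) comm_ring_1
begin

lift_definition zero_tate :: "'a tate" is "\<lambda>_. 0"
  by simp

lift_definition one_tate :: "'a tate" is "\<lambda>M. if M = {#} then 1 else 0"
proof -
  fix e :: real assume "e > 0"
  show "finite {M::nat multiset. e \<le> absv (if M = {#} then 1 else 0 :: 'a)}"
    by (rule finite_subset[of _ "{{#}}"]) (use \<open>e > 0\<close> in \<open>auto split: if_splits\<close>)
qed

lift_definition plus_tate :: "'a tate \<Rightarrow> 'a tate \<Rightarrow> 'a tate" is "\<lambda>f g M. f M + g M"
proof -
  fix f g :: "nat multiset \<Rightarrow> 'a" and e :: real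
  assume *: "\<And>e. e > 0 \<Longrightarrow> finite {M. e \<le> absv (f M)}"
    "\<And>e. e > 0 \<Longrightarrow> finite {M. e \<le> absv (g M)}" "e > 0"
  have "e \<le> absv (f M) \<or> e \<le> absv (g M)" if "e \<le> absv (f M + g M)" for M
    using that absv_add[of "f M" "g M"] by linarith
  then have "{M. e \<le> absv (f M + g M)} \<subseteq> {M. e \<le> absv (f M)} \<union> {M. e \<le> absv (g M)}"
    by auto
  then show "finite {M. e \<le> absv (f M + g M)}"
    by (rule finite_subset) (use * in simp)
qed

lift_definition uminus_tate :: "'a tate \<Rightarrow> 'a tate" is "\<lambda>f M. - f M"
  by simp

lift_definition minus_tate :: "'a tate \<Rightarrow> 'a tate \<Rightarrow> 'a tate" is "\<lambda>f g M. f M - g M"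
proof -
  fix f g :: "nat multiset \<Rightarrow> 'a" and e :: real
  assume *: "\<And>e. e > 0 \<Longrightarrow> finite {M. e \<le> absv (f M)}"
    "\<And>e. e > 0 \<Longrightarrow> finite {M. e \<le> absv (g M)}" "e > 0"
  have "e \<le> absv (f M) \<or> e \<le> absv (g M)" if "e \<le> absv (f M - g M)" for M
    using that absv_diff[of "f M" "g M"] by linarith
  then have "{M. e \<le> absv (f M - g M)} \<subseteq> {M. e \<le> absv (f M)} \<union> {M. e \<le> absv (g M)}"
    by auto
  then show "finite {M. e \<le> absv (f M - g M)}"
    by (rule finite_subset) (use * in simp)
qed

lift_definition times_tate :: "'a tate \<Rightarrow> 'a tate \<Rightarrow> 'a tate" is
  "\<lambda>f g M. \<Sum>(A, B) \<in> {(A, B). A + B = M}. f A * g B"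
proof -
  fix f g :: "nat multiset \<Rightarrow> 'a" and e :: real
  assume *: "\<And>e. e > 0 \<Longrightarrow> finite {M. e \<le> absv (f M)}"
    "\<And>e. e > 0 \<Longrightarrow> finite {M. e \<le> absv (g M)}" "e > 0"
  obtain B where B: "B > 0" "\<And>M. absv (f M) \<le> B"
    using null_family_bounded[OF *(1)] by blast
  obtain C where C: "C > 0" "\<And>M. absv (g M) \<le> C"
    using null_family_bounded[OF *(2)] by blast
  let ?F = "{M. e / 2 / C \<le> absv (f M)}" and ?G = "{M. e / 2 / B \<le> absv (g M)}"
  have "{M. e \<le> absv (\<Sum>(A, B) \<in> {(A, B). A + B = M}. f A * g B)}
      \<subseteq> (\<lambda>(A, B). A + B) ` (?F \<times> ?G)"
  proof
    fix M assume "M \<in> {M. e \<le> absv (\<Sum>(A, B) \<in> {(A, B). A + B = M}. f A * g B)}"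
    then have M: "e \<le> absv (\<Sum>(A, B) \<in> {(A, B). A + B = M}. f A * g B)" by simp
    have "\<exists>A B. A + B = M \<and> e / 2 < absv (f A * g B)"
    proof (rule ccontr)
      assume "\<not> ?thesis"
      then have "absv (\<Sum>(A, B) \<in> {(A, B). A + B = M}. f A * g B) \<le> e / 2"
        using \<open>e > 0\<close> by (intro absv_sum finite_splits) (auto simp: not_less)
      with M \<open>e > 0\<close> show False by linarith
    qed
    then obtain A A' where A: "A + A' = M" "e / 2 < absv (f A) * absv (g A')"
      by (auto simp: absv_mult)
    have "absv (f A) * absv (g A') \<le> absv (f A) * C"
      using C by (intro mult_left_mono) auto
    then have "e / 2 / C \<le> absv (f A)"
      using A(2) C(1) by (simp add: field_simps)
    moreover have "absv (f A) * absv (g A') \<le> B * absv (g A')"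
      using B by (intro mult_right_mono) auto
    then have "e / 2 / B \<le> absv (g A')"
      using A(2) B(1) by (simp add: field_simps)
    ultimately show "M \<in> (\<lambda>(A, B). A + B) ` (?F \<times> ?G)"
      using A(1) by force
  qed
  moreover have "finite ?F" "finite ?G"
    using *(3) B(1) C(1) by (auto intro!: *(1,2))
  ultimately show "finite {M. e \<le> absv (\<Sum>(A, B) \<in> {(A, B). A + B = M}. f A * g B)}"
    by (rule finite_subset[OF _ finite_imageI[OF finite_cartesian_product]])
qed

instance
proof
  fix f g h :: "'a tate"
  show "f + g + h = f + (g + h)" by transfer (simp add: add.assoc)
  show "f + g = g + f" by transfer (simp add: add.commute)
  show "0 + f = f" by transfer simp
  show "- f + f = 0" by transfer simp
  show "f - g = f + - g" by transfer simp
  show "(f + g) * h = f * h + g * h"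
    by transfer (simp add: sum.distrib[symmetric] distrib_right case_prod_unfold)
  show "(0::'a tate) \<noteq> 1"
    by transfer (metis zero_neq_one)
  show "1 * f = f"
  proof (transfer, rule ext)
    fix f :: "nat multiset \<Rightarrow> 'a" and M
    have "(\<Sum>(A, B) \<in> {(A, B). A + B = M}. (if A = {#} then 1 else 0) * f B)
        = (\<Sum>(A, B) \<in> {({#}::nat multiset, M)}. (if A = {#} then 1 else 0) * f B)"
      by (rule sum.mono_neutral_right[OF finite_splits]) (auto split: if_splits)
    then show "(\<Sum>(A, B) \<in> {(A, B). A + B = M}. (if A = {#} then 1 else 0) * f B) = f M"
      by simp
  qed
  show "f * g = g * f"
  proof (transfer, rule ext)
    fix f g :: "nat multiset \<Rightarrow> 'a" and M
    show "(\<Sum>(A, B) \<in> {(A, B). A + B = M}. f A * g B)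
        = (\<Sum>(A, B) \<in> {(A, B). A + B = M}. g A * f B)"
      by (rule sum.reindex_bij_witness[of _ prod.swap prod.swap])
        (auto simp: add.commute mult.commute)
  qed
  show "f * g * h = f * (g * h)"
  proof (transfer, rule ext)
    fix f g h :: "nat multiset \<Rightarrow> 'a" and M
    have "(\<Sum>(A, B) \<in> {(A, B). A + B = M}. (\<Sum>(C, D) \<in> {(C, D). C + D = A}. f C * g D) * h B)
        = (\<Sum>p \<in> {(A, B). A + B = M}. \<Sum>r \<in> {(C, D). C + D = fst p}.
             f (fst r) * g (snd r) * h (snd p))"
      by (simp add: sum_distrib_right case_prod_unfold)
    also have "\<dots> = (\<Sum>(p, r) \<in> (SIGMA p:{(A, B). A + B = M}. {(C, D). C + D = fst p}).
             f (fst r) * g (snd r) * h (snd p))"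
      by (rule sum.Sigma) (auto simp: finite_splits)
    also have "\<dots> = (\<Sum>(p, r) \<in> (SIGMA p:{(A, B). A + B = M}. {(C, D). C + D = snd p}).
             f (fst p) * (g (fst r) * h (snd r)))"
      by (rule sum.reindex_bij_witness[of _
            "\<lambda>((A, B), (C, D)). ((A + C, D), (A, C))" "\<lambda>((A, B), (C, D)). ((C, D + B), (D, B))"])
        (auto simp: algebra_simps)
    also have "\<dots> = (\<Sum>p \<in> {(A, B). A + B = M}. \<Sum>r \<in> {(C, D). C + D = snd p}.
             f (fst p) * (g (fst r) * h (snd r)))"
      by (rule sum.Sigma[symmetric]) (auto simp: finite_splits)
    also have "\<dots> = (\<Sum>(A, B) \<in> {(A, B). A + B = M}.
             f A * (\<Sum>(C, D) \<in> {(C, D). C + D = B}. g C * h D))"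
      by (simp add: sum_distrib_left case_prod_unfold)
    finally show "(\<Sum>(A, B) \<in> {(A, B). A + B = M}.
             (\<Sum>(A, B) \<in> {(C, D). C + D = A}. f A * g B) * h B)
        = (\<Sum>(A, B) \<in> {(A, B). A + B = M}. f A * (\<Sum>(A, B) \<in> {(C, D). C + D = B}. g A * h B))" .
  qed
qed

end

definition gauss_norm :: "'c::nonarch_field tate \<Rightarrow> real" where
  "gauss_norm f = (SUP M. absv (tate_coeff f M))"

lemma bdd_above_tate: "bdd_above (range (\<lambda>M. absv (tate_coeff f M)))"
proof -
  obtain B where "\<And>M. absv (tate_coeff f M) \<le> B"
    using null_family_bounded[of "tate_coeff f"] finite_tate_coeff by metis
  then show ?thesis by (intro bdd_aboveI) auto
qed

lemma gauss_norm_coeff_le: "absv (tate_coeff f M) \<le> gauss_norm f"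
  unfolding gauss_norm_def by (rule cSUP_upper[OF _ bdd_above_tate]) simp

lemma gauss_norm_le: "(\<And>M. absv (tate_coeff f M) \<le> B) \<Longrightarrow> gauss_norm f \<le> B"
  unfolding gauss_norm_def by (rule cSUP_least) auto

lemma gauss_norm_nonneg: "0 \<le> gauss_norm (f::'c::nonarch_field tate)"
  by (rule order_trans[OF absv_nonneg gauss_norm_coeff_le])

lemma gauss_norm_add: "gauss_norm (f + g) \<le> max (gauss_norm f) (gauss_norm (g::'c::nonarch_field tate))"
proof (rule gauss_norm_le)
  fix M
  show "absv (tate_coeff (f + g) M) \<le> max (gauss_norm f) (gauss_norm g)"
    using absv_add[of "tate_coeff f M" "tate_coeff g M"]
      gauss_norm_coeff_le[of f M] gauss_norm_coeff_le[of g M]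
    by (simp add: plus_tate.rep_eq)
qed

lemma gauss_norm_mult: "gauss_norm (f * g) \<le> gauss_norm f * gauss_norm (g::'c::nonarch_field tate)"
proof (rule gauss_norm_le)
  fix M
  show "absv (tate_coeff (f * g) M) \<le> gauss_norm f * gauss_norm g"
    unfolding times_tate.rep_eq
    by (intro absv_sum finite_splits)
      (auto simp: absv_mult gauss_norm_nonneg intro!: mult_mono gauss_norm_coeff_le)
qed

lemma gauss_norm_minus: "gauss_norm (- f) = gauss_norm (f::'c::nonarch_field tate)"
  by (simp add: gauss_norm_def uminus_tate.rep_eq)

instantiation tate :: (nonarch_field) metric_space
begin

definition dist_tate :: "'a tate \<Rightarrow> 'a tate \<Rightarrow> real" where
  "dist_tate f g = gauss_norm (f - g)"

definition uniformity_tate :: "('a tate \<times> 'a tate) filter" where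
  "uniformity_tate = (INF e\<in>{0 <..}. principal {(x, y). dist x y < e})"

definition open_tate :: "'a tate set \<Rightarrow> bool" where
  "open_tate U = (\<forall>x\<in>U. \<forall>\<^sub>F (x', y) in uniformity. x' = x \<longrightarrow> y \<in> U)"

instance
proof
  fix f g h :: "'a tate" and U :: "'a tate set"
  show "uniformity = (INF e\<in>{0 <..}. principal {(x::'a tate, y). dist x y < e})"
    by (fact uniformity_tate_def)
  show "open U = (\<forall>x\<in>U. \<forall>\<^sub>F (x', y) in uniformity. x' = x \<longrightarrow> y \<in> U)"
    by (fact open_tate_def)
  show "dist f g = 0 \<longleftrightarrow> f = g"
  proof
    assume "dist f g = 0"
    then have "absv (tate_coeff f M - tate_coeff g M) \<le> 0" for M
      using gauss_norm_coeff_le[of "f - g" M] by (simp add: dist_absv dist_tate_def minus_tate.rep_eq)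
    then have "tate_coeff f M - tate_coeff g M = 0" for M
      using absv_nonneg absv_eq_zero by (metis order_antisym)
    then show "f = g" by (intro tate_eqI) simp
  next
    assume "f = g"
    then show "dist f g = 0"
      by (simp add: dist_absv dist_tate_def gauss_norm_def zero_tate.rep_eq)
  qed
  have "gauss_norm (f - g) \<le> max (gauss_norm (f - h)) (gauss_norm (g - h))"
    using gauss_norm_add[of "f - h" "- (g - h)"] by (simp only: gauss_norm_minus) simp
  then show "dist f g \<le> dist f h + dist g h"
    using gauss_norm_nonneg[of "f - h"] gauss_norm_nonneg[of "g - h"]
    unfolding dist_absv dist_tate_def by linarith
qed

end

instance tate :: (nonarch_field) topological_ab_group_add
proof
  fix a b :: "'a tate"
  have *: "dist (x + y) (a + b) \<le> max (dist x a) (dist y b)" for x y :: "'a tate"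
    using gauss_norm_add[of "x - a" "y - b"] by (simp add: dist_absv dist_tate_def algebra_simps)
  show "LIM x nhds a \<times>\<^sub>F nhds b. fst x + snd x :> nhds (a + b)"
    unfolding nhds_prod[symmetric]
  proof (rule tendstoI)
    fix e :: real assume e: "e > 0"
    have "\<forall>\<^sub>F x in nhds a \<times>\<^sub>F nhds b. dist (fst x) a < e \<and> dist (snd x) b < e"
      using e by (intro eventually_prodI) (auto simp: eventually_nhds_metric)
    then show "\<forall>\<^sub>F x in nhds (a, b). dist (fst x + snd x) (a + b) < e"
      unfolding nhds_prod
      by (rule eventually_mono) (rule le_less_trans[OF *], simp)
  qed
  show "(uminus \<longlongrightarrow> - a) (nhds a)"
  proof (rule tendstoI)
    fix e :: real assume e: "e > 0"
    have "dist (- x) (- a) = dist x a" for x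
      using gauss_norm_minus[of "x - a"] by (simp add: dist_absv dist_tate_def)
    then show "\<forall>\<^sub>F x in nhds a. dist (- x) (- a) < e"
      using e by (auto simp: eventually_nhds_metric)
  qed
qed

instance tate :: ("{nonarch_field,complete_space}") complete_space
proof
  fix X :: "nat \<Rightarrow> 'a tate"
  assume X: "Cauchy X"
  have d: "dist (tate_coeff f M) (tate_coeff g M) \<le> dist f g" for f g :: "'a tate" and M
    using gauss_norm_coeff_le[of "f - g" M] by (simp add: dist_absv dist_tate_def minus_tate.rep_eq)
  have "Cauchy (\<lambda>n. tate_coeff (X n) M)" for M
    using X unfolding Cauchy_def by (meson d le_less_trans)
  then obtain l where l: "\<And>M. (\<lambda>n. tate_coeff (X n) M) \<longlonglongrightarrow> l M"
    unfolding Cauchy_convergent_iff convergent_def by metis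
  have unif: "\<exists>N. \<forall>n\<ge>N. \<forall>M. dist (tate_coeff (X n) M) (l M) \<le> e" if e: "e > 0" for e
  proof -
    obtain N where N: "\<And>m n. m \<ge> N \<Longrightarrow> n \<ge> N \<Longrightarrow> dist (X m) (X n) < e"
      using X e unfolding Cauchy_def by blast
    have "dist (tate_coeff (X n) M) (l M) \<le> e" if "n \<ge> N" for n M
    proof (rule tendsto_upperbound)
      show "(\<lambda>k. dist (tate_coeff (X n) M) (tate_coeff (X k) M))
          \<longlonglongrightarrow> dist (tate_coeff (X n) M) (l M)"
        by (intro tendsto_intros l)
      show "\<forall>\<^sub>F k in sequentially. dist (tate_coeff (X n) M) (tate_coeff (X k) M) \<le> e"
        using N[OF that] d[of "X n" M] unfolding eventually_sequentially
        by (meson less_imp_le order_trans)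
    qed simp
    then show ?thesis by blast
  qed
  have "\<forall>e>0. finite {M. e \<le> absv (l M)}"
  proof (intro allI impI)
    fix e :: real assume e: "e > 0"
    then obtain N where N: "\<And>M. dist (tate_coeff (X N) M) (l M) \<le> e / 2"
      using unif[of "e / 2"] by auto
    have "absv (l M) \<le> max (absv (tate_coeff (X N) M)) (e / 2)" for M
      using absv_diff[of "tate_coeff (X N) M" "tate_coeff (X N) M - l M"] N[of M]
      by (simp add: dist_absv dist_tate_def)
    then have "{M. e \<le> absv (l M)} \<subseteq> {M. e \<le> absv (tate_coeff (X N) M)}"
      using e by (smt (verit) Collect_mono field_sum_of_halves)
    then show "finite {M. e \<le> absv (l M)}"
      using finite_tate_coeff[OF e] finite_subset by blast
  qed
  then obtain L where L: "tate_coeff L = l"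
    using Abs_tate_inverse[of l] by auto
  have "X \<longlonglongrightarrow> L"
  proof (rule metric_LIMSEQ_I)
    fix e :: real assume e: "e > 0"
    then obtain N where N: "\<And>n M. n \<ge> N \<Longrightarrow> dist (tate_coeff (X n) M) (l M) \<le> e / 2"
      using unif[of "e / 2"] by auto
    have "dist (X n) L \<le> e / 2" if "n \<ge> N" for n
      unfolding dist_absv dist_tate_def
      by (rule gauss_norm_le) (use N[OF that] L in \<open>simp add: minus_tate.rep_eq dist_absv dist_tate_def\<close>)
    then show "\<exists>N. \<forall>n\<ge>N. dist (X n) L < e"
      using e by (intro exI[of _ N]) fastforce
  qed
  then show "convergent X" by (auto simp: convergent_def)
qed

definition tate_in :: "nat set \<Rightarrow> 'c::nonarch_field tate set" where
  "tate_in S = {f. \<forall>M. tate_coeff f M \<noteq> 0 \<longrightarrow> set_mset M \<subseteq> S}"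

lemma closed_tate_in: "closed (tate_in S :: 'c::nonarch_field tate set)"
proof (rule closed_sequential_limits[THEN iffD2], intro allI impI, elim conjE)
  fix X and L :: "'c tate"
  assume X: "\<forall>n. X n \<in> tate_in S" "X \<longlonglongrightarrow> L"
  show "L \<in> tate_in S"
    unfolding tate_in_def
  proof (intro CollectI allI impI, rule ccontr)
    fix M assume M: "tate_coeff L M \<noteq> 0" "\<not> set_mset M \<subseteq> S"
    then have "absv (tate_coeff L M) > 0"
      using absv_nonneg absv_eq_zero by (metis order_less_le)
    then obtain n where n: "dist (X n) L < absv (tate_coeff L M)"
      using X(2) unfolding lim_sequentially by blast
    have "tate_coeff (X n) M = 0"
      using X(1) M(2) unfolding tate_in_def by blast
    then show False
      using n gauss_norm_coeff_le[of "X n - L" M] by (simp add: dist_absv dist_tate_def minus_tate.rep_eq)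
  qed
qed

lemma tate_in_eq_closure:
  "tate_in S = closure {f \<in> tate_in S. finite {M. tate_coeff f M \<noteq> (0::'c::nonarch_field)}}"
    (is "_ = closure ?P")
proof
  show "closure ?P \<subseteq> tate_in S"
    by (rule closure_minimal[OF _ closed_tate_in]) blast
  show "tate_in S \<subseteq> closure ?P"
  proof
    fix f :: "'c tate" assume f: "f \<in> tate_in S"
    show "f \<in> closure ?P"
      unfolding closure_approachable
    proof (intro allI impI)
      fix e :: real assume e: "e > 0"
      define p where "p = (\<lambda>M. if e / 2 \<le> absv (tate_coeff f M) then tate_coeff f M else 0)"
      have fin: "finite {M. p M \<noteq> 0}"
        by (rule finite_subset[of _ "{M. e / 2 \<le> absv (tate_coeff f M)}"])
          (use finite_tate_coeff[of "e / 2" f] e in \<open>auto simp: p_def\<close>)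
      have "finite {M. d \<le> absv (p M)}" if "d > 0" for d
        by (rule finite_subset[OF _ fin]) (use that in auto)
      then obtain g where g: "tate_coeff g = p"
        using Abs_tate_inverse[of p] by auto
      have "g \<in> ?P"
        using f fin unfolding tate_in_def by (auto simp: g p_def)
      moreover have "dist g f \<le> e / 2"
        unfolding dist_absv dist_tate_def using e
        by (intro gauss_norm_le) (auto simp: minus_tate.rep_eq g p_def)
      ultimately show "\<exists>y\<in>?P. dist y f < e"
        using e by (intro bexI[of _ g]) auto
    qed
  qed
qed

lift_definition tate_const :: "'c::nonarch_field \<Rightarrow> 'c tate" is "\<lambda>c M. if M = {#} then c else 0"
proof -
  fix c :: 'c and e :: real assume "e > 0"
  show "finite {M::nat multiset. e \<le> absv (if M = {#} then c else 0)}"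
    by (rule finite_subset[of _ "{{#}}"]) (use \<open>e > 0\<close> in \<open>auto split: if_splits\<close>)
qed

lift_definition tate_var :: "nat \<Rightarrow> 'c::nonarch_field tate" is "\<lambda>n M. if M = {#n#} then 1 else 0"
proof -
  fix n :: nat and e :: real assume "e > 0"
  show "finite {M::nat multiset. e \<le> absv (if M = {#n#} then 1 else 0 :: 'c)}"
    by (rule finite_subset[of _ "{{#n#}}"]) (use \<open>e > 0\<close> in \<open>auto split: if_splits\<close>)
qed


section \<open>Multiple zeta values\<close>

text \<open>A finite weighted subset \<open>{\<sigma>\<^sub>n}\<close> of the positive integers is a multiset with \<open>count \<Sigma> n = \<sigma>\<^sub>n\<close>.
  Then \<open>|\<Sigma>|\<close>, the support, \<open>J \<subseteq> \<Sigma>\<close> and \<open>\<Sigma> \<squnion> \<Gamma>\<close> are \<^const>\<open>size\<close>, \<^const>\<open>set_mset\<close>,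
  \<open>J \<subseteq># \<Sigma>\<close> and \<open>\<Sigma> + \<Gamma>\<close>.\<close>

definition weighted_subset :: "nat multiset \<Rightarrow> bool" where
  "weighted_subset \<Sigma> \<longleftrightarrow> set_mset \<Sigma> \<subseteq> {1..}"

definition mset_binomial :: "nat multiset \<Rightarrow> nat multiset \<Rightarrow> nat" where
  "mset_binomial \<Sigma> J = (\<Prod>n\<in>set_mset \<Sigma>. count \<Sigma> n choose count J n)"

definition embed_A :: "('a::field fls \<Rightarrow> 'c) \<Rightarrow> 'a poly \<Rightarrow> 'c" where
  "embed_A \<iota> a = \<iota> (poly (map_poly fls_const a) fls_X_inv)"

definition subst_var :: "('a::field fls \<Rightarrow> 'c::nonarch_field) \<Rightarrow> 'a poly \<Rightarrow> nat \<Rightarrow> 'c tate" where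
  "subst_var \<iota> a n = poly (map_poly (\<lambda>c. tate_const (\<iota> (fls_const c))) a) (tate_var n)"

definition chi :: "('a::field fls \<Rightarrow> 'c::nonarch_field) \<Rightarrow> nat multiset \<Rightarrow> 'a poly \<Rightarrow> 'c tate" where
  "chi \<iota> \<Sigma> a = (\<Prod>n\<in>set_mset \<Sigma>. subst_var \<iota> a n ^ count \<Sigma> n)"

definition zeta_index :: "nat \<Rightarrow> 'a::field poly list set" where
  "zeta_index r = {as. length as = r \<and> (\<forall>a\<in>set as. lead_coeff a = 1)
     \<and> sorted_wrt (\<lambda>a b. degree a > degree b) as}"

text \<open>The list \<open>[(\<Sigma>\<^sub>1, s\<^sub>1), \<dots>, (\<Sigma>\<^sub>r, s\<^sub>r)]\<close> encodes the two-row array of arguments.  The sum is the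
  unconditional one with respect to the Gauss norm.\<close>

definition zeta ::
  "('a::field fls \<Rightarrow> 'c::nonarch_field) \<Rightarrow> (nat multiset \<times> nat) list \<Rightarrow> 'c tate" where
  "zeta \<iota> ws = (\<Sum>\<^sub>\<infinity>as\<in>zeta_index (length ws).
     (\<Prod>i<length ws. chi \<iota> (fst (ws ! i)) (as ! i)) *
     tate_const (1 / (\<Prod>i<length ws. embed_A \<iota> (as ! i) ^ snd (ws ! i))))"

definition Delta ::
  "nat \<Rightarrow> nat multiset \<Rightarrow> nat \<Rightarrow> nat multiset \<Rightarrow> nat \<Rightarrow> int" where
  "Delta q \<Sigma> j J s = (if [size J = j] (mod (q - 1))
     then (-1) ^ (size J + s - 1) * int (mset_binomial \<Sigma> J) * int ((j - 1) choose (s - 1)) else 0)"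

definition stuffle_index ::
  "nat multiset \<Rightarrow> nat multiset \<Rightarrow> nat \<Rightarrow> (nat multiset \<times> nat multiset \<times> nat \<times> nat) set" where
  "stuffle_index \<Omega> \<Lambda> w = {(I, J, i, j). J \<subseteq># \<Lambda> \<and> I + J = \<Omega> \<and> i > 0 \<and> j > 0 \<and> i + j = w}"

end

theory Submission
  imports Defs
begin

text \<open>Write \<open>F\<^sub>\<Sigma>\<^sub>,\<^sub>s(a) = \<chi>\<^sub>\<Sigma>(a) / a\<^sup>s\<close>, and truncate every zeta value to leading polynomials of degree
  less than \<open>d\<close>.  The product formula already holds exactly for the truncated values, which are
  finite sums (\<open>zeta1_below_mult\<close>).  Since the terms tend to zero and the Gauss norm is ultrametric,
  the truncated values converge to the zeta values (\<open>zeta_tendsto\<close>), and multiplication in the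
  Tate algebra is continuous, so the identity passes to the limit \<open>d \<rightarrow> \<infinity>\<close>.

  For the finite identity, expand the product as a sum of \<open>F\<^sub>\<Sigma>\<^sub>,\<^sub>s(a) F\<^sub>\<Gamma>\<^sub>,\<^sub>t(b)\<close> over pairs of monic
  polynomials of degree less than \<open>d\<close>.  The pairs with \<open>deg a > deg b\<close>, those with \<open>deg a < deg b\<close>
  and those with \<open>a = b\<close> give the first three terms of the formula.  For distinct \<open>a\<close>, \<open>b\<close> of
  equal degree put \<open>c = a - b\<close>, a nonzero polynomial of degree less than \<open>deg a\<close>, and use the partial
  fraction decomposition (\<open>partial_fraction\<close>)
  that expresses \<open>1 / (a\<^sup>s b\<^sup>t)\<close> as the sum over \<open>i + j = s + t\<close> of
  \<open>(-1)\<^sup>t (j-1 choose t-1) / (a\<^sup>i c\<^sup>j)\<close> and \<open>(-1)\<^sup>s (j-1 choose s-1) / (b\<^sup>i (-c)\<^sup>j)\<close>.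
  In the first part replace \<open>b\<close> by \<open>a - c\<close> and expand \<open>\<chi>\<^sub>\<Gamma>(a - c)\<close> by the binomial theorem
  (\<open>prod_mset_binomial\<close>); this yields the terms \<open>F\<^sub>I\<^sub>,\<^sub>i(a) F\<^sub>J\<^sub>,\<^sub>j(c)\<close> with \<open>J \<subseteq> \<Gamma>\<close> and \<open>I \<squnion> J = \<Sigma> \<squnion> \<Gamma>\<close>.
  Finally \<open>c\<close> is a nonzero scalar \<open>\<lambda>\<close> times a monic polynomial of smaller degree than \<open>a\<close>, and
  \<open>\<lambda>\<close> enters through the factor \<open>\<lambda> ^ (|J| - j)\<close>.  Summing over \<open>\<lambda>\<close> gives \<open>-1\<close> if
  \<open>|J| \<equiv> j\<close> modulo \<open>q - 1\<close> and \<open>0\<close> otherwise (\<open>sum_power_finite_field\<close>), which is where the shape of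
  \<^const>\<open>Delta\<close> comes from.  The second part is the first one with the roles of \<open>(\<Sigma>, s, a)\<close> and
  \<open>(\<Gamma>, t, b)\<close> exchanged.\<close>


section \<open>Analysis in the Tate algebra\<close>

instance tate :: (nonarch_field) topological_semigroup_mult
proof
  fix a b :: "'a tate"
  \<comment> \<open>The radius \<open>d\<close> is at most one so that the quadratic term \<open>(x - a) (y - b)\<close> is bounded by \<open>d\<close>.\<close>
  have bound: "dist (x * y) (a * b) < e"
    if e: "0 < e" and d: "d = min 1 (e / (1 + gauss_norm a + gauss_norm b))"
      and x: "dist x a < d" and y: "dist y b < d" for x y :: "'a tate" and d e
  proof -
    have pos: "1 + gauss_norm a + gauss_norm b > 0"
      using gauss_norm_nonneg[of a] gauss_norm_nonneg[of b] by linarith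
    have xa: "gauss_norm (x - a) < d" and yb: "gauss_norm (y - b) < d"
      using x y by (simp_all add: dist_tate_def)
    have d1: "d \<le> 1" "0 < d" and "d \<le> e / (1 + gauss_norm a + gauss_norm b)"
      using pos e by (simp_all add: d)
    then have de: "d * (1 + gauss_norm a + gauss_norm b) \<le> e"
      using pos by (simp add: pos_le_divide_eq)
    have "x * y - a * b = (x - a) * (y - b) + ((x - a) * b + a * (y - b))"
      by (simp add: algebra_simps)
    then have "gauss_norm (x * y - a * b)
        \<le> max (gauss_norm ((x - a) * (y - b)))
             (max (gauss_norm ((x - a) * b)) (gauss_norm (a * (y - b))))"
      using gauss_norm_add[of "(x - a) * (y - b)" "(x - a) * b + a * (y - b)"]
        gauss_norm_add[of "(x - a) * b" "a * (y - b)"] by simp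
    also have "\<dots> < d * (1 + gauss_norm a + gauss_norm b)"
    proof -
      have nn: "0 \<le> d * gauss_norm a" "0 \<le> d * gauss_norm b"
        using d1 gauss_norm_nonneg[of a] gauss_norm_nonneg[of b] by simp_all
      have "gauss_norm (x - a) * gauss_norm (y - b) \<le> gauss_norm (x - a) * 1"
        using yb d1 gauss_norm_nonneg[of "x - a"] by (intro mult_left_mono) auto
      then have 1: "gauss_norm ((x - a) * (y - b)) < d"
        using gauss_norm_mult[of "x - a" "y - b"] xa by linarith
      have "gauss_norm (x - a) * gauss_norm b \<le> d * gauss_norm b"
        using xa gauss_norm_nonneg[of b] by (intro mult_right_mono) auto
      then have 2: "gauss_norm ((x - a) * b) \<le> d * gauss_norm b"
        using gauss_norm_mult[of "x - a" b] by linarith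
      have "gauss_norm a * gauss_norm (y - b) \<le> gauss_norm a * d"
        using yb gauss_norm_nonneg[of a] by (intro mult_left_mono) auto
      then have 3: "gauss_norm (a * (y - b)) \<le> d * gauss_norm a"
        using gauss_norm_mult[of a "y - b"] by (simp add: mult.commute)
      show ?thesis
        using 1 2 3 nn d1 by (simp add: distrib_left)
    qed
    finally show ?thesis
      using de by (simp add: dist_tate_def)
  qed
  show "LIM x nhds a \<times>\<^sub>F nhds b. fst x * snd x :> nhds (a * b)"
    unfolding nhds_prod[symmetric]
  proof (rule tendstoI)
    fix e :: real assume e: "e > 0"
    define d where "d = min 1 (e / (1 + gauss_norm a + gauss_norm b))"
    have "d > 0"
      using e gauss_norm_nonneg[of a] gauss_norm_nonneg[of b] by (simp add: d_def)
    then have "\<forall>\<^sub>F x in nhds a \<times>\<^sub>F nhds b. dist (fst x) a < d \<and> dist (snd x) b < d"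
      by (intro eventually_prodI) (auto simp: eventually_nhds_metric)
    then show "\<forall>\<^sub>F x in nhds (a, b). dist (fst x * snd x) (a * b) < e"
      unfolding nhds_prod by (rule eventually_mono) (use bound[OF e d_def] in simp)
  qed
qed

lemma gauss_norm_zero [simp]: "gauss_norm (0::'c::nonarch_field tate) = 0"
  by (simp add: gauss_norm_def zero_tate.rep_eq)

lemma gauss_norm_sum_le:
  fixes f :: "'b \<Rightarrow> 'c::nonarch_field tate"
  assumes "0 \<le> B" "\<And>x. x \<in> S \<Longrightarrow> gauss_norm (f x) \<le> B"
  shows "gauss_norm (sum f S) \<le> B"
  using assms
proof (induction S rule: infinite_finite_induct)
  case (insert x F)
  then show ?case
    using gauss_norm_add[of "f x" "sum f F"] by fastforce
qed auto

text \<open>In an ultrametric space a sum of many small terms is small, so a family whose terms tend to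
  zero is summable and its sum is the limit along any exhaustion by finite sets.  This is what
  reduces identities between zeta values to identities between finite sums.\<close>

lemma tate_exhaustion_tendsto_infsum:
  fixes f :: "'b \<Rightarrow> 'c::{nonarch_field,complete_space} tate"
  assumes fin: "\<And>d. finite (S d)" and mono: "mono S" and A: "A = (\<Union>d. S d)"
    and small: "\<And>e. e > 0 \<Longrightarrow> \<exists>d. \<forall>x\<in>A - S d. gauss_norm (f x) \<le> e"
  shows "(\<lambda>d. sum f (S d)) \<longlonglongrightarrow> infsum f A"
proof -
  have tail: "dist (sum f X) (sum f (S d)) \<le> e"
    if "0 < e" "\<forall>x\<in>A - S d. gauss_norm (f x) \<le> e" "finite X" "S d \<subseteq> X" "X \<subseteq> A" for X d e
  proof -
    have "sum f X - sum f (S d) = sum f (X - S d)"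
      using that by (simp add: sum_diff)
    then show ?thesis
      using that by (auto simp: dist_tate_def intro!: gauss_norm_sum_le)
  qed
  have "Cauchy (\<lambda>d. sum f (S d))"
    unfolding Cauchy_altdef2
  proof (intro allI impI)
    fix e :: real assume e: "e > 0"
    then obtain d where d: "\<forall>x\<in>A - S d. gauss_norm (f x) \<le> e / 2"
      using small[of "e / 2"] by auto
    have "dist (sum f (S n)) (sum f (S d)) < e" if "n \<ge> d" for n
      using tail[OF _ d, of "S n"] fin monoD[OF mono that] A e by fastforce
    then show "\<exists>N. \<forall>n\<ge>N. dist (sum f (S n)) (sum f (S N)) < e" by blast
  qed
  then obtain L where L: "(\<lambda>d. sum f (S d)) \<longlonglongrightarrow> L"
    unfolding Cauchy_convergent_iff convergent_def by blast
  have "(f has_sum L) A"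
    unfolding has_sum_def
  proof (rule tendstoI)
    fix e :: real assume e: "e > 0"
    obtain d where d: "\<forall>x\<in>A - S d. gauss_norm (f x) \<le> e / 2"
      using small[of "e / 2"] e by auto
    obtain N where N: "\<And>n. n \<ge> N \<Longrightarrow> dist (sum f (S n)) L < e / 2"
      using L e unfolding lim_sequentially by (meson half_gt_zero)
    define m where "m = max d N"
    have m: "\<forall>x\<in>A - S m. gauss_norm (f x) \<le> e / 2"
      using d monoD[OF mono, of d m] by (auto simp: m_def)
    have "dist (sum f X) L < e" if X: "finite X" "S m \<subseteq> X" "X \<subseteq> A" for X
      using tail[OF _ m X] e N[of m] dist_triangle[of "sum f X" L "sum f (S m)"]
      by (auto simp: m_def)
    then show "\<forall>\<^sub>F X in finite_subsets_at_top A. dist (sum f X) L < e"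
      unfolding eventually_finite_subsets_at_top using fin[of m] A by blast
  qed
  then show ?thesis
    using L by (simp add: infsumI)
qed

lemma tate_coeff_const_mult: "tate_coeff (tate_const c * f) M = c * tate_coeff f M"
proof -
  have "tate_coeff (tate_const c * f) M
      = (\<Sum>(A, B) \<in> {({#} :: nat multiset, M)}. (if A = {#} then c else 0) * tate_coeff f B)"
    unfolding times_tate.rep_eq tate_const.rep_eq
    by (rule sum.mono_neutral_right[OF finite_splits]) (auto split: if_splits)
  then show ?thesis by simp
qed

lemma tate_const_mult: "tate_const (c * d) = tate_const c * tate_const d"
  by (rule tate_eqI) (simp add: tate_coeff_const_mult tate_const.rep_eq)

lemma tate_const_add: "tate_const (c + d) = tate_const c + tate_const d"
  by (rule tate_eqI) (simp add: tate_const.rep_eq plus_tate.rep_eq)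

lemma tate_const_diff: "tate_const (c - d) = tate_const c - tate_const d"
  by (rule tate_eqI) (simp add: tate_const.rep_eq minus_tate.rep_eq)

lemma tate_const_uminus: "tate_const (- c) = - tate_const c"
  by (rule tate_eqI) (simp add: tate_const.rep_eq uminus_tate.rep_eq)

lemma tate_const_0 [simp]: "tate_const 0 = 0"
  by (rule tate_eqI) (simp add: tate_const.rep_eq zero_tate.rep_eq)

lemma tate_const_1 [simp]: "tate_const 1 = 1"
  by (rule tate_eqI) (simp add: tate_const.rep_eq one_tate.rep_eq)

lemma tate_const_power: "tate_const (c ^ n) = tate_const c ^ n"
  by (induction n) (simp_all add: tate_const_mult)

lemma tate_const_sum: "tate_const (sum f S) = (\<Sum>x\<in>S. tate_const (f x))"
  by (induction S rule: infinite_finite_induct) (simp_all add: tate_const_add)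

lemma gauss_norm_const: "gauss_norm (tate_const c) \<le> absv c"
  by (rule gauss_norm_le) (simp add: tate_const.rep_eq)

lemma gauss_norm_one: "gauss_norm (1::'c::nonarch_field tate) \<le> 1"
  using gauss_norm_const[of "1::'c"] by simp

lemma gauss_norm_var: "gauss_norm (tate_var n) \<le> 1"
  by (rule gauss_norm_le) (simp add: tate_var.rep_eq)

lemma gauss_norm_mult_le:
  fixes f g :: "'c::nonarch_field tate"
  assumes "gauss_norm f \<le> B" "gauss_norm g \<le> C"
  shows "gauss_norm (f * g) \<le> B * C"
  using assms gauss_norm_nonneg[of f] gauss_norm_nonneg[of g]
  by (intro order_trans[OF gauss_norm_mult] mult_mono) auto

lemma gauss_norm_power_le:
  fixes f :: "'c::nonarch_field tate"
  shows "gauss_norm f \<le> B \<Longrightarrow> gauss_norm (f ^ n) \<le> B ^ n"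
  by (induction n) (auto intro: gauss_norm_mult_le gauss_norm_one)

lemma gauss_norm_prod_le:
  fixes f :: "'b \<Rightarrow> 'c::nonarch_field tate"
  shows "(\<And>x. x \<in> S \<Longrightarrow> gauss_norm (f x) \<le> B x) \<Longrightarrow> gauss_norm (prod f S) \<le> prod B S"
  by (induction S rule: infinite_finite_induct) (auto intro: gauss_norm_mult_le gauss_norm_one)


section \<open>Finite algebraic identities\<close>

text \<open>The part of the partial fraction decomposition of \<open>1 / (a\<^sup>s (a - c)\<^sup>t)\<close> with poles
  at \<open>a = 0\<close>, where \<open>x = 1 / a\<close> and \<open>z = 1 / c\<close>: expand \<open>(a - c) ^ (- t)\<close> in powers of \<open>a\<close>
  and keep the \<open>s\<close> terms that are polar after division by \<open>a\<^sup>s\<close>.  For \<open>t = 0\<close> the truncated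
  subtraction makes only the coefficient at \<open>k = 0\<close> nonzero, so that the value is \<open>x\<^sup>s\<close>, which
  makes the recursion below start correctly.\<close>

definition principal_part :: "'r::comm_ring_1 \<Rightarrow> 'r \<Rightarrow> nat \<Rightarrow> nat \<Rightarrow> 'r" where
  "principal_part x z s t = (-1) ^ t * (\<Sum>k<s. of_nat ((t + k - 1) choose k) * x ^ (s - k) * z ^ (t + k))"

lemma principal_part_0_left [simp]: "principal_part x z 0 t = 0"
  by (simp add: principal_part_def)

lemma principal_part_0_right: "s > 0 \<Longrightarrow> principal_part x z s 0 = x ^ s"
proof -
  assume s: "s > 0"
  have "principal_part x z s 0 = (\<Sum>k<s. of_nat ((k - 1) choose k) * x ^ (s - k) * z ^ k)"
    by (simp add: principal_part_def)
  also have "\<dots> = (\<Sum>k\<in>{0}. of_nat ((k - 1) choose k) * x ^ (s - k) * z ^ k)"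
    using s by (intro sum.mono_neutral_right) (auto simp: binomial_eq_0)
  finally show ?thesis by simp
qed

text \<open>The recursion comes from Pascal's rule.  It is the one satisfied by \<open>x\<^sup>s y\<^sup>t\<close>
  when \<open>x y = z (y - x)\<close>.\<close>

lemma principal_part_Suc_Suc:
  "principal_part x z (Suc s) (Suc t)
    = z * (principal_part x z s (Suc t) - principal_part x z (Suc s) t)"
proof -
  have "z * principal_part x z s (Suc t)
      = - ((-1) ^ t) * (\<Sum>k<s. of_nat ((t + k) choose k) * x ^ (s - k) * z ^ Suc (Suc t + k))"
    by (simp add: principal_part_def sum_distrib_left mult_ac)
  moreover have "z * principal_part x z (Suc s) t
      = (-1) ^ t * (\<Sum>k<Suc s. of_nat ((t + k - 1) choose k) * x ^ (Suc s - k) * z ^ Suc (t + k))"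
    by (simp only: principal_part_def sum_distrib_left) (simp add: sum_distrib_left mult_ac)
  moreover have "(\<Sum>k<Suc s. of_nat ((t + k - 1) choose k) * x ^ (Suc s - k) * z ^ Suc (t + k))
      = x ^ Suc s * z ^ Suc t
        + (\<Sum>k<s. of_nat ((t + k) choose Suc k) * x ^ (s - k) * z ^ Suc (Suc t + k))"
    by (subst sum.lessThan_Suc_shift) simp
  moreover have "principal_part x z (Suc s) (Suc t) = - ((-1) ^ t) * (x ^ Suc s * z ^ Suc t
        + (\<Sum>k<s. of_nat (Suc (t + k) choose Suc k) * x ^ (s - k) * z ^ Suc (Suc t + k)))"
    unfolding principal_part_def by (subst sum.lessThan_Suc_shift) simp
  ultimately show ?thesis
    by (simp only: binomial_Suc_Suc of_nat_add)
      (simp add: sum.distrib algebra_simps)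
qed

text \<open>With \<open>x = 1 / a\<close>, \<open>y = 1 / b\<close> and \<open>z = 1 / (a - b)\<close> the hypothesis is the identity
  \<open>1 / (a b) = (1 / b - 1 / a) / (a - b)\<close>.  Both sides of the conclusion satisfy the same recursion
  in \<open>(s, t)\<close> and agree when \<open>s = 0\<close> or \<open>t = 0\<close>; the exchange of \<open>a\<close> and \<open>b\<close> turns \<open>z\<close> into
  \<open>- z\<close>.\<close>

lemma partial_fraction:
  fixes x y z :: "'r::comm_ring_1"
  assumes xy: "x * y = z * (y - x)"
  shows "s > 0 \<or> t > 0 \<Longrightarrow> x ^ s * y ^ t = principal_part x z s t + principal_part y (- z) t s"
proof (induction "s + t" arbitrary: s t rule: less_induct)
  case less
  show ?case
  proof (cases "s = 0 \<or> t = 0")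
    case True
    then show ?thesis
      using less.prems by (auto simp: principal_part_0_right)
  next
    case False
    then obtain s' t' where [simp]: "s = Suc s'" "t = Suc t'"
      by (metis not0_implies_Suc)
    have "x ^ s * y ^ t = (x * y) * (x ^ s' * y ^ t')"
      by (simp add: mult_ac)
    also have "\<dots> = z * (x ^ s' * y ^ t - x ^ s * y ^ t')"
      by (simp add: xy algebra_simps)
    also have "x ^ s' * y ^ t = principal_part x z s' t + principal_part y (- z) t s'"
      by (rule less.hyps) auto
    also have "x ^ s * y ^ t' = principal_part x z s t' + principal_part y (- z) t' s"
      by (rule less.hyps) auto
    finally show ?thesis
      by (simp add: principal_part_Suc_Suc algebra_simps)
  qed
qed

text \<open>Reindexing by \<open>j = t + k\<close> gives the form in which the coefficients of \<^const>\<open>Delta\<close> are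
  visible; the added indices \<open>j < t\<close> have vanishing binomial coefficients.\<close>

lemma principal_part_altdef:
  assumes "s > 0" "t > 0"
  shows "principal_part x z s t
    = (\<Sum>j\<in>{1..<s + t}. (-1) ^ t * of_nat ((j - 1) choose (t - 1)) * x ^ (s + t - j) * z ^ j)"
proof -
  have "(\<Sum>j\<in>{1..<s + t}. (-1) ^ t * of_nat ((j - 1) choose (t - 1)) * x ^ (s + t - j) * z ^ j)
      = (\<Sum>j\<in>{t..<s + t}. (-1) ^ t * of_nat ((j - 1) choose (t - 1)) * x ^ (s + t - j) * z ^ j)"
    using assms by (intro sum.mono_neutral_right) (auto simp: binomial_eq_0)
  also have "\<dots> = (\<Sum>k\<in>{..<s}. (-1) ^ t * of_nat ((t + k - 1) choose k) * x ^ (s - k) * z ^ (t + k))"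
  proof (rule sum.reindex_bij_witness[of _ "\<lambda>k. t + k" "\<lambda>j. j - t"])
    fix j assume j: "j \<in> {t..<s + t}"
    have "(j - 1) choose (j - t) = (j - 1) choose (t - 1)"
      using binomial_symmetric[OF diff_le_mono[of t j 1]] j assms by simp
    then show "(-1) ^ t * of_nat ((t + (j - t) - 1) choose (j - t)) * x ^ (s - (j - t)) * z ^ (t + (j - t))
        = (-1) ^ t * of_nat ((j - 1) choose (t - 1)) * x ^ (s + t - j) * z ^ j"
      using j by (simp add: add.commute)
  qed auto
  finally show ?thesis
    by (simp add: principal_part_def sum_distrib_left mult_ac)
qed

text \<open>Expand \<open>\<Prod>\<^sub>n (x\<^sub>n + y\<^sub>n) ^ count \<Gamma> n\<close> factor by factor with the binomial theorem; a choice of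
  one exponent for each factor is the same thing as a multiset \<open>J \<subseteq># \<Gamma>\<close>.\<close>

lemma prod_mset_binomial:
  fixes x y :: "nat \<Rightarrow> 'r::comm_ring_1"
  shows "(\<Prod>n\<in>#\<Gamma>. x n + y n)
    = (\<Sum>J | J \<subseteq># \<Gamma>. of_nat (mset_binomial \<Gamma> J) * (\<Prod>n\<in>#\<Gamma> - J. x n) * (\<Prod>n\<in>#J. y n))"
proof -
  define S where "S = set_mset \<Gamma>"
  define w where "w = (\<lambda>n k. of_nat (count \<Gamma> n choose k) * y n ^ k * x n ^ (count \<Gamma> n - k))"
  have prod_on_S: "(\<Prod>n\<in>#J. u n) = (\<Prod>n\<in>S. u n ^ count J n)" if "J \<subseteq># \<Gamma>" for J and u :: "nat \<Rightarrow> 'r"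
    unfolding image_prod_mset_multiplicity S_def using set_mset_mono[OF that]
    by (intro prod.mono_neutral_left) (auto simp: not_in_iff)
  have "(\<Prod>n\<in>#\<Gamma>. x n + y n) = (\<Prod>n\<in>S. (y n + x n) ^ count \<Gamma> n)"
    by (simp add: image_prod_mset_multiplicity S_def add.commute)
  also have "\<dots> = (\<Prod>n\<in>S. \<Sum>k\<in>{..count \<Gamma> n}. w n k)"
    by (simp add: binomial_ring w_def)
  also have "\<dots> = (\<Sum>g\<in>PiE S (\<lambda>n. {..count \<Gamma> n}). \<Prod>n\<in>S. w n (g n))"
    by (rule prod_sum_PiE) (auto simp: S_def)
  also have "\<dots> = (\<Sum>J | J \<subseteq># \<Gamma>. of_nat (mset_binomial \<Gamma> J) * (\<Prod>n\<in>#\<Gamma> - J. x n) * (\<Prod>n\<in>#J. y n))"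
  proof (rule sum.reindex_bij_witness[of _ "\<lambda>J. restrict (count J) S"
          "\<lambda>g. \<Sum>n\<in>S. replicate_mset (g n) n"])
    fix g assume g: "g \<in> PiE S (\<lambda>n. {..count \<Gamma> n})"
    have cnt: "count (\<Sum>n\<in>S. replicate_mset (g n) n) m = (if m \<in> S then g m else 0)" for m
      by (simp add: count_sum S_def)
    show "restrict (count (\<Sum>n\<in>S. replicate_mset (g n) n)) S = g"
      using g by (auto simp: cnt fun_eq_iff restrict_def PiE_def extensional_def)
    show sub: "(\<Sum>n\<in>S. replicate_mset (g n) n) \<in> {J. J \<subseteq># \<Gamma>}"
      using g by (auto simp: subseteq_mset_def cnt PiE_def Pi_def)
    show "of_nat (mset_binomial \<Gamma> (\<Sum>n\<in>S. replicate_mset (g n) n))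
          * (\<Prod>n\<in>#\<Gamma> - (\<Sum>n\<in>S. replicate_mset (g n) n). x n)
          * (\<Prod>n\<in>#(\<Sum>n\<in>S. replicate_mset (g n) n). y n) = (\<Prod>n\<in>S. w n (g n))"
      using sub
      by (simp add: prod_on_S mset_binomial_def cnt w_def prod.distrib mult_ac flip: S_def)
  next
    fix J assume J: "J \<in> {J. J \<subseteq># \<Gamma>}"
    then have le: "count J n \<le> count \<Gamma> n" for n
      by (simp add: subseteq_mset_def)
    then show "restrict (count J) S \<in> PiE S (\<lambda>n. {..count \<Gamma> n})" by auto
    show "(\<Sum>n\<in>S. replicate_mset (restrict (count J) S n) n) = J"
    proof (rule multiset_eqI)
      fix n
      show "count (\<Sum>n\<in>S. replicate_mset (restrict (count J) S n) n) n = count J n"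
        using le[of n] by (simp add: count_sum S_def not_in_iff)
    qed
  qed
  finally show ?thesis .
qed

text \<open>Multiplication by \<open>x\<close> permutes the nonzero elements and so preserves their product.\<close>

lemma power_card_minus_1_eq_1:
  fixes x :: "'a::{finite,field}"
  assumes "x \<noteq> 0"
  shows "x ^ (CARD('a) - 1) = 1"
proof -
  have "(\<Prod>y\<in>UNIV - {0}. y) = (\<Prod>y\<in>UNIV - {0}. x * y)"
    by (rule prod.reindex_bij_witness[of _ "\<lambda>y. x * y" "\<lambda>y. y / x"]) (use assms in auto)
  also have "\<dots> = x ^ (CARD('a) - 1) * (\<Prod>y\<in>UNIV - {0}. y)"
    by (simp add: prod.distrib)
  finally show ?thesis
    by simp
qed

lemma of_nat_CARD_eq_0: "of_nat CARD('a) = (0::'a::{finite,field})"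
proof -
  have "(\<Sum>x\<in>UNIV. x) = (\<Sum>x\<in>UNIV. x + (1::'a))"
    by (rule sum.reindex_bij_witness[of _ "\<lambda>x. x + 1" "\<lambda>x. x - 1"]) auto
  then show ?thesis
    by (simp add: sum.distrib)
qed

text \<open>Let \<open>q\<close> be the order of the field.  If \<open>m\<close> and \<open>j\<close> differ modulo \<open>q - 1\<close>, reduce them modulo
  \<open>q - 1\<close> first: then \<open>X ^ m - X ^ j\<close> is a nonzero polynomial of degree less than \<open>q - 1\<close>, so some
  nonzero \<open>g\<close> is not a root of it.  The substitution \<open>x \<mapsto> g x\<close> multiplies the sum by
  \<open>g ^ m / g ^ j \<noteq> 1\<close>, so the sum vanishes.\<close>

lemma sum_power_finite_field:
  "(\<Sum>x\<in>UNIV - {0::'a::{finite,field}}. x ^ m * inverse x ^ j)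
    = (if [m = j] (mod (CARD('a) - 1)) then -1 else 0)"
proof -
  define q where "q = CARD('a) - 1"
  have q: "card (UNIV - {0::'a}) = q"
    by (simp add: q_def)
  have red: "x ^ n = x ^ (n mod q)" if "x \<noteq> 0" for x :: 'a and n
    using power_card_minus_1_eq_1[OF that]
    by (metis mult.commute mult_div_mod_eq power_add power_mult power_one mult_1 q_def)
  show ?thesis
  proof (cases "[m = j] (mod q)")
    case True
    have "x ^ m * inverse x ^ j = 1" if "x \<noteq> 0" for x :: 'a
    proof -
      have "x ^ m = x ^ j"
        using red[OF that, of m] red[OF that, of j] True by (simp add: cong_def)
      then show ?thesis
        using that by (simp flip: power_mult_distrib)
    qed
    then have "(\<Sum>x\<in>UNIV - {0::'a}. x ^ m * inverse x ^ j) = of_nat q"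
      by (simp add: q)
    also have "\<dots> = of_nat CARD('a) - 1"
      by (simp add: q_def of_nat_diff)
    finally show ?thesis
      using True by (simp add: of_nat_CARD_eq_0 q_def)
  next
    case False
    have qpos: "q > 0"
    proof -
      have "(1::'a) \<in> UNIV - {0}" by simp
      then show ?thesis
        unfolding q[symmetric] card_gt_0_iff by (metis empty_iff finite)
    qed
    obtain g :: 'a where g: "g \<noteq> 0" "g ^ m \<noteq> g ^ j"
    proof (rule ccontr)
      assume contra: "\<not> thesis"
      have eq: "g ^ (m mod q) = g ^ (j mod q)" if "g \<noteq> 0" for g :: 'a
        using red[OF that, of m] red[OF that, of j] contra \<open>\<And>g. g \<noteq> 0 \<Longrightarrow> g ^ m \<noteq> g ^ j \<Longrightarrow> thesis\<close> that
        by metis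
      define p :: "'a poly" where "p = monom 1 (m mod q) - monom 1 (j mod q)"
      have "coeff p (m mod q) = 1"
        using False by (simp add: p_def cong_def)
      then have "p \<noteq> 0" by auto
      have "degree p \<le> max (m mod q) (j mod q)"
        unfolding p_def by (rule order_trans[OF degree_diff_le_max]) (auto simp: degree_monom_eq)
      then have "degree p < q"
        using qpos by (meson le_less_trans max_less_iff_conj mod_less_divisor)
      moreover have "UNIV - {0} \<subseteq> {x. poly p x = 0}"
        using eq by (auto simp: p_def poly_monom)
      then have "q \<le> card {x. poly p x = 0}"
        unfolding q[symmetric] by (rule card_mono[rotated]) simp
      ultimately show False
        using card_poly_roots_bound[OF \<open>p \<noteq> 0\<close>] by simp
    qed
    let ?S = "\<Sum>x\<in>UNIV - {0::'a}. x ^ m * inverse x ^ j"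
    have "?S = (\<Sum>x\<in>UNIV - {0}. (g * x) ^ m * inverse (g * x) ^ j)"
      by (rule sum.reindex_bij_witness[of _ "\<lambda>x. g * x" "\<lambda>x. x / g"]) (use g in auto)
    also have "\<dots> = g ^ m * inverse g ^ j * ?S"
      by (simp add: power_mult_distrib sum_distrib_left mult_ac)
    finally have "?S = 0 \<or> g ^ m * inverse g ^ j = 1"
      by simp
    moreover have "g ^ m * inverse g ^ j \<noteq> 1"
      using g by (simp add: power_inverse field_simps)
    ultimately show ?thesis
      using False by (simp add: q_def)
  qed
qed


section \<open>Evaluating polynomials in the valued field and in the Tate algebra\<close>

text \<open>Both \<^const>\<open>embed_A\<close> and \<^const>\<open>subst_var\<close> satisfy the Horner recursion assumed in the next
  two lemmas.\<close>

lemma horner_add: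
  fixes f :: "'b::comm_ring_1 poly \<Rightarrow> 'r::comm_ring_1"
  assumes "f 0 = 0" "\<And>c p. f (pCons c p) = \<phi> c + x * f p" "\<And>c d. \<phi> (c + d) = \<phi> c + \<phi> d"
  shows "f (p + q) = f p + f q"
  by (induction p q rule: poly_induct2) (simp_all add: assms algebra_simps)

lemma horner_smult:
  fixes f :: "'b::comm_ring_1 poly \<Rightarrow> 'r::comm_ring_1"
  assumes "f 0 = 0" "\<And>c p. f (pCons c p) = \<phi> c + x * f p" "\<And>c d. \<phi> (c * d) = \<phi> c * \<phi> d"
  shows "f (smult c p) = \<phi> c * f p"
  by (induction p) (simp_all add: assms algebra_simps)

lemma two_le_CARD: "2 \<le> CARD('a::{finite,field})"
proof -
  have "card {0, 1::'a} \<le> CARD('a)"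
    by (rule card_mono) auto
  then show ?thesis by simp
qed

lemma absv_power: "absv (x ^ n) = absv (x :: 'c::nonarch_field) ^ n"
  by (induction n) (simp_all add: absv_mult)

lemma absv_prod: "absv (prod f S) = (\<Prod>x\<in>S. absv (f x :: 'c::nonarch_field))"
  by (induction S rule: infinite_finite_induct) (simp_all add: absv_mult)

lemma absv_inverse: "absv (1 / x) = 1 / absv (x :: 'c::nonarch_field)"
proof (cases "x = 0")
  case False
  then have "absv x * absv (1 / x) = 1"
    by (simp flip: absv_mult)
  then show ?thesis
    using False by (simp add: field_simps)
qed simp

text \<open>The embedding of the constants \<open>F\<^sub>q\<close> into the valued field.\<close>

definition scalar :: "('a::field fls \<Rightarrow> 'c) \<Rightarrow> 'a \<Rightarrow> 'c" where
  "scalar \<iota> c = \<iota> (fls_const c)"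

definition inv_A :: "('a::field fls \<Rightarrow> 'c::nonarch_field) \<Rightarrow> 'a poly \<Rightarrow> 'c tate" where
  "inv_A \<iota> a = tate_const (1 / embed_A \<iota> a)"

definition zeta_term ::
  "('a::field fls \<Rightarrow> 'c::nonarch_field) \<Rightarrow> nat multiset \<Rightarrow> nat \<Rightarrow> 'a poly \<Rightarrow> 'c tate" where
  "zeta_term \<iota> \<Sigma> s a = chi \<iota> \<Sigma> a * inv_A \<iota> a ^ s"

lemma chi_altdef: "chi \<iota> \<Sigma> a = (\<Prod>n\<in>#\<Sigma>. subst_var \<iota> a n)"
  by (simp add: chi_def image_prod_mset_multiplicity)

lemma chi_union: "chi \<iota> (\<Sigma> + \<Gamma>) a = chi \<iota> \<Sigma> a * chi \<iota> \<Gamma> a"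
  by (simp add: chi_altdef)

context C_infty
begin

lemma hom_zero [simp]: "\<iota> 0 = 0"
  using hom_add[of 0 0] by (metis add_0 add_cancel_right_right)

lemma scalar_add: "scalar \<iota> (c + d) = scalar \<iota> c + scalar \<iota> d"
  by (simp add: scalar_def flip: hom_add fls_plus_const)

lemma scalar_mult: "scalar \<iota> (c * d) = scalar \<iota> c * scalar \<iota> d"
  by (simp add: scalar_def flip: hom_mult)

lemma scalar_0 [simp]: "scalar \<iota> 0 = 0" and scalar_1 [simp]: "scalar \<iota> 1 = 1"
  by (simp_all add: scalar_def hom_one)

lemma scalar_uminus: "scalar \<iota> (- c) = - scalar \<iota> c"
  using scalar_add[of c "- c"] by (simp add: eq_neg_iff_add_eq_0 add.commute)

lemma scalar_power: "scalar \<iota> (c ^ n) = scalar \<iota> c ^ n"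
  by (induction n) (simp_all add: scalar_mult)

lemma scalar_sum: "scalar \<iota> (sum f S) = (\<Sum>x\<in>S. scalar \<iota> (f x))"
  by (induction S rule: infinite_finite_induct) (simp_all add: scalar_add)

lemma absv_scalar: "absv (scalar \<iota> c) = (if c = 0 then 0 else 1)"
  by (simp add: scalar_def norm_hom Kinf_norm_def)

lemma scalar_inverse:
  assumes "c \<noteq> 0"
  shows "scalar \<iota> (inverse c) = 1 / scalar \<iota> c"
proof -
  have "scalar \<iota> c \<noteq> 0"
    using absv_scalar[of c] assms by auto
  moreover have "scalar \<iota> (inverse c) * scalar \<iota> c = 1"
    using assms by (simp flip: scalar_mult)
  ultimately show ?thesis
    by (simp add: eq_divide_eq)
qed

lemma embed_A_0 [simp]: "embed_A \<iota> 0 = 0"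
  by (simp add: embed_A_def)

lemma embed_A_pCons: "embed_A \<iota> (pCons c p) = scalar \<iota> c + \<iota> fls_X_inv * embed_A \<iota> p"
  by (simp add: embed_A_def scalar_def map_poly_pCons hom_add hom_mult)

lemma embed_A_add: "embed_A \<iota> (p + q) = embed_A \<iota> p + embed_A \<iota> q"
  by (rule horner_add[where f = "embed_A \<iota>" and \<phi> = "scalar \<iota>"])
    (rule embed_A_0 embed_A_pCons scalar_add)+

lemma embed_A_diff: "embed_A \<iota> (p - q) = embed_A \<iota> p - embed_A \<iota> q"
  using embed_A_add[of "p - q" q] by simp

lemma embed_A_smult: "embed_A \<iota> (smult c p) = scalar \<iota> c * embed_A \<iota> p"
  by (rule horner_smult[where f = "embed_A \<iota>" and \<phi> = "scalar \<iota>"])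
    (rule embed_A_0 embed_A_pCons scalar_mult)+

lemma subst_var_0 [simp]: "subst_var \<iota> 0 n = 0"
  by (simp add: subst_var_def)

lemma subst_var_pCons:
  "subst_var \<iota> (pCons c p) n = tate_const (scalar \<iota> c) + tate_var n * subst_var \<iota> p n"
  by (simp add: subst_var_def scalar_def map_poly_pCons)

lemma subst_var_add: "subst_var \<iota> (p + q) n = subst_var \<iota> p n + subst_var \<iota> q n"
  by (rule horner_add[where f = "\<lambda>p. subst_var \<iota> p n" and \<phi> = "\<lambda>c. tate_const (scalar \<iota> c)"])
    (simp_all add: subst_var_pCons scalar_add tate_const_add)

lemma subst_var_diff: "subst_var \<iota> (p - q) n = subst_var \<iota> p n - subst_var \<iota> q n"
  using subst_var_add[of "p - q" q n] by simp

lemma subst_var_smult: "subst_var \<iota> (smult c p) n = tate_const (scalar \<iota> c) * subst_var \<iota> p n"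
  by (rule horner_smult[where f = "\<lambda>p. subst_var \<iota> p n" and \<phi> = "\<lambda>c. tate_const (scalar \<iota> c)"])
    (simp_all add: subst_var_pCons scalar_mult tate_const_mult)

text \<open>In a Horner step the summand \<open>\<theta> p\<close> has absolute value greater than one, so it dominates
  the constant.\<close>

lemma absv_embed_A_ge: "a \<noteq> 0 \<Longrightarrow> real CARD('a) ^ degree a \<le> absv (embed_A \<iota> a)"
proof (induction a)
  case (pCons c p)
  let ?q = "real CARD('a)"
  show ?case
  proof (cases "p = 0")
    case True
    then show ?thesis
      using pCons by (simp add: embed_A_pCons absv_scalar)
  next
    case False
    define y where "y = \<iota> fls_X_inv * embed_A \<iota> p"
    have q: "?q > 1"
      using two_le_CARD[where 'a = 'a] by simp
    have "absv (\<iota> fls_X_inv) = ?q"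
      by (simp add: norm_hom Kinf_norm_def)
    then have y: "?q ^ degree (pCons c p) \<le> absv y"
      using pCons False q by (simp add: y_def absv_mult)
    have "1 < ?q ^ degree (pCons c p)"
      by (rule one_less_power[OF q]) (use False in simp)
    moreover have "absv y \<le> max (absv (embed_A \<iota> (pCons c p))) (absv (scalar \<iota> c))"
      using absv_diff[of "embed_A \<iota> (pCons c p)" "scalar \<iota> c"]
      by (simp add: embed_A_pCons y_def)
    ultimately show ?thesis
      using y by (auto simp: absv_scalar max_def split: if_splits)
  qed
qed simp

lemma absv_embed_A_ge_1: "a \<noteq> 0 \<Longrightarrow> 1 \<le> absv (embed_A \<iota> a)"
proof -
  assume "a \<noteq> 0"
  moreover have "1 \<le> real CARD('a) ^ degree a"
    using two_le_CARD[where 'a = 'a] by (intro one_le_power) simp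
  ultimately show ?thesis
    using absv_embed_A_ge[of a] by linarith
qed

lemma embed_A_nonzero: "a \<noteq> 0 \<Longrightarrow> embed_A \<iota> a \<noteq> 0"
  using absv_embed_A_ge_1[of a] by auto

lemma inv_A_uminus: "inv_A \<iota> (- a) = - inv_A \<iota> a"
  using embed_A_diff[of 0 a] by (simp add: inv_A_def flip: tate_const_uminus)

text \<open>This is the hypothesis of \<open>partial_fraction\<close>.\<close>

lemma inv_A_mult:
  assumes "a \<noteq> 0" "b \<noteq> 0" "a \<noteq> b"
  shows "inv_A \<iota> a * inv_A \<iota> b = inv_A \<iota> (a - b) * (inv_A \<iota> b - inv_A \<iota> a)"
proof -
  have "embed_A \<iota> a \<noteq> 0" "embed_A \<iota> b \<noteq> 0" "embed_A \<iota> a - embed_A \<iota> b \<noteq> 0"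
    using assms embed_A_nonzero[of a] embed_A_nonzero[of b] embed_A_nonzero[of "a - b"]
    by (simp_all add: embed_A_diff)
  then have "1 / embed_A \<iota> a * (1 / embed_A \<iota> b)
      = 1 / (embed_A \<iota> a - embed_A \<iota> b) * (1 / embed_A \<iota> b - 1 / embed_A \<iota> a)"
    by (simp add: divide_simps)
  then show ?thesis
    by (simp add: inv_A_def embed_A_diff flip: tate_const_mult tate_const_diff)
qed

lemma gauss_norm_subst_var: "gauss_norm (subst_var \<iota> p n) \<le> 1"
proof (induction p)
  case (pCons c p)
  have "gauss_norm (tate_const (scalar \<iota> c)) \<le> 1"
    using gauss_norm_const[of "scalar \<iota> c"] by (simp add: absv_scalar split: if_splits)
  moreover have "gauss_norm (tate_var n * subst_var \<iota> p n) \<le> 1 * 1"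
    by (intro gauss_norm_mult_le gauss_norm_var pCons.IH)
  ultimately show ?case
    using gauss_norm_add[of "tate_const (scalar \<iota> c)" "tate_var n * subst_var \<iota> p n"]
    by (simp add: subst_var_pCons)
qed simp

lemma gauss_norm_chi: "gauss_norm (chi \<iota> \<Sigma> a) \<le> 1"
proof -
  have "gauss_norm (chi \<iota> \<Sigma> a) \<le> (\<Prod>n\<in>set_mset \<Sigma>. 1 ^ count \<Sigma> n)"
    unfolding chi_def by (intro gauss_norm_prod_le gauss_norm_power_le gauss_norm_subst_var)
  then show ?thesis by simp
qed

lemma chi_smult: "chi \<iota> \<Sigma> (smult c a) = tate_const (scalar \<iota> c) ^ size \<Sigma> * chi \<iota> \<Sigma> a"
  by (induction \<Sigma>) (simp_all add: chi_altdef subst_var_smult mult_ac)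

lemma chi_diff:
  "chi \<iota> \<Gamma> (a - c) = (\<Sum>J | J \<subseteq># \<Gamma>.
     of_nat (mset_binomial \<Gamma> J) * chi \<iota> (\<Gamma> - J) a * ((-1) ^ size J * chi \<iota> J c))"
proof -
  have "(\<Prod>n\<in>#J. - subst_var \<iota> c n) = (-1) ^ size J * (\<Prod>n\<in>#J. subst_var \<iota> c n)" for J
    by (induction J) (simp_all add: mult_ac)
  then show ?thesis
    using prod_mset_binomial[of "subst_var \<iota> a" "\<lambda>n. - subst_var \<iota> c n" \<Gamma>]
    by (simp add: chi_altdef subst_var_diff)
qed

text \<open>The terms are homogeneous of degree \<open>|J| - j\<close> under scalars; the scalar factor is kept inside
  \<open>F\<^sub>q\<close> so that it can be summed there.\<close>

lemma zeta_term_smult: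
  assumes "c \<noteq> 0"
  shows "zeta_term \<iota> J j (smult c a)
    = tate_const (scalar \<iota> (c ^ size J * inverse c ^ j)) * zeta_term \<iota> J j a"
proof -
  have "inv_A \<iota> (smult c a) = tate_const (scalar \<iota> (inverse c)) * inv_A \<iota> a"
    using assms by (simp add: inv_A_def embed_A_smult scalar_inverse flip: tate_const_mult)
  then show ?thesis
    by (simp add: zeta_term_def chi_smult scalar_mult scalar_power tate_const_mult
        tate_const_power power_mult_distrib mult_ac)
qed

end


section \<open>Truncated zeta values\<close>

definition monics :: "nat \<Rightarrow> 'a::{finite,field} poly set" where
  "monics d = {a. lead_coeff a = 1 \<and> degree a < d}"

lemma monics_nonzero: "a \<in> monics d \<Longrightarrow> a \<noteq> 0"
  by (auto simp: monics_def)

lemma finite_monics: "finite (monics d :: 'a::{finite,field} poly set)"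
proof -
  have "finite (coeffs -` {xs :: 'a list. set xs \<subseteq> UNIV \<and> length xs \<le> d})"
    by (intro finite_vimageI finite_lists_length_le injI) (simp_all add: coeffs_eq_iff)
  moreover have "length (coeffs a) \<le> d" if "a \<in> monics d" for a :: "'a poly"
    using that monics_nonzero[OF that] by (simp add: monics_def length_coeffs_degree)
  then have "monics d \<subseteq> coeffs -` {xs :: 'a list. set xs \<subseteq> UNIV \<and> length xs \<le> d}"
    by auto
  ultimately show ?thesis
    by (rule finite_subset[rotated])
qed

definition zeta_index_below :: "nat \<Rightarrow> nat \<Rightarrow> 'a::{finite,field} poly list set" where
  "zeta_index_below r d = {as \<in> zeta_index r. set as \<subseteq> monics d}"

lemma finite_zeta_index_below: "finite (zeta_index_below r d)"
  by (rule finite_subset[OF _ finite_lists_length_eq[OF finite_monics[of d], of r]])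
    (auto simp: zeta_index_below_def zeta_index_def)

lemma zeta_index_below_1: "zeta_index_below 1 d = (\<lambda>a. [a]) ` monics d"
  by (auto simp: zeta_index_below_def zeta_index_def monics_def length_Suc_conv)

lemma zeta_index_below_2:
  "zeta_index_below 2 d = (\<lambda>(a, b). [a, b]) ` (SIGMA a:monics d. monics (degree a))"
  by (auto simp: zeta_index_below_def zeta_index_def monics_def length_Suc_conv numeral_2_eq_2
      image_iff)

text \<open>In depth two only the degree of the leading polynomial is bounded explicitly: the other degree is
  smaller.\<close>

definition zeta1_below where
  "zeta1_below \<iota> d \<Sigma> s = (\<Sum>a\<in>monics d. zeta_term \<iota> \<Sigma> s a)"

definition zeta2_below where
  "zeta2_below \<iota> d \<Sigma> s \<Gamma> t
    = (\<Sum>a\<in>monics d. zeta_term \<iota> \<Sigma> s a * (\<Sum>b\<in>monics (degree a). zeta_term \<iota> \<Gamma> t b))"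

context C_infty
begin

text \<open>The factors \<open>\<chi>\<^sub>\<Sigma>(a)\<close> have Gauss norm at most one, and \<open>|1 / a| \<le> q ^ (- deg a)\<close>.  So a summand in
  which some degree is at least \<open>d\<close> has Gauss norm at most \<open>q ^ (- d)\<close>, since its exponents are
  positive.\<close>

lemma zeta_tendsto:
  assumes pos: "\<And>i. i < length ws \<Longrightarrow> snd (ws ! i) > 0"
  shows "(\<lambda>d. \<Sum>as\<in>zeta_index_below (length ws) d.
     (\<Prod>i<length ws. chi \<iota> (fst (ws ! i)) (as ! i)) *
     tate_const (1 / (\<Prod>i<length ws. embed_A \<iota> (as ! i) ^ snd (ws ! i)))) \<longlonglongrightarrow> zeta \<iota> ws"
  unfolding zeta_def
proof (rule tate_exhaustion_tendsto_infsum)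
  let ?r = "length ws" and ?q = "real CARD('a)"
  show "finite (zeta_index_below ?r d)" for d
    by (rule finite_zeta_index_below)
  show "mono (zeta_index_below ?r :: nat \<Rightarrow> 'a poly list set)"
    by (auto simp: mono_def zeta_index_below_def monics_def)
  show "(zeta_index ?r :: 'a poly list set) = (\<Union>d. zeta_index_below ?r d)"
  proof -
    have "\<exists>d. set as \<subseteq> monics d" if as: "as \<in> zeta_index ?r" for as :: "'a poly list"
    proof (intro exI subsetI)
      fix a assume a: "a \<in> set as"
      then have "degree a < Suc (Max (degree ` set as))"
        by (intro le_imp_less_Suc Max_ge) auto
      then show "a \<in> monics (Suc (Max (degree ` set as)))"
        using as a unfolding monics_def zeta_index_def by blast
    qed
    then show ?thesis
      by (auto simp: zeta_index_below_def)
  qed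
  fix e :: real assume e: "e > 0"
  have q: "?q > 1"
    using two_le_CARD[where 'a = 'a] by simp
  obtain d where d: "1 / e < ?q ^ d"
    using real_arch_pow[OF q] by blast
  have "gauss_norm ((\<Prod>i<?r. chi \<iota> (fst (ws ! i)) (as ! i)) *
      tate_const (1 / (\<Prod>i<?r. embed_A \<iota> (as ! i) ^ snd (ws ! i)))) \<le> e"
    if as: "as \<in> zeta_index ?r - zeta_index_below ?r d" for as
  proof -
    have nz: "as ! i \<noteq> 0" if "i < ?r" for i
    proof -
      have "lead_coeff (as ! i) = 1"
        using as that nth_mem[of i as] by (simp add: zeta_index_def)
      then show ?thesis by auto
    qed
    obtain a where "a \<in> set as" "d \<le> degree a"
      using as by (force simp: zeta_index_def zeta_index_below_def monics_def)
    then obtain k where k: "k < ?r" "d \<le> degree (as ! k)"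
      using as by (auto simp: zeta_index_def in_set_conv_nth)
    define u where "u = (\<lambda>i. absv (embed_A \<iota> (as ! i)) ^ snd (ws ! i))"
    have u: "1 \<le> u i" if "i < ?r" for i
      unfolding u_def by (intro one_le_power absv_embed_A_ge_1 nz that)
    have "?q ^ d \<le> ?q ^ degree (as ! k)"
      using q k by (intro power_increasing) auto
    also have "\<dots> \<le> absv (embed_A \<iota> (as ! k))"
      by (intro absv_embed_A_ge nz k)
    also have "\<dots> = absv (embed_A \<iota> (as ! k)) ^ 1"
      by simp
    also have "\<dots> \<le> u k"
      unfolding u_def using pos[OF k(1)]
      by (intro power_increasing absv_embed_A_ge_1 nz k) simp
    also have "\<dots> \<le> u k * (\<Prod>i\<in>{..<?r} - {k}. u i)"
    proof -
      have "1 \<le> (\<Prod>i\<in>{..<?r} - {k}. u i)"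
        by (rule prod_ge_1) (simp add: u)
      then show ?thesis
        using mult_left_mono[of 1 _ "u k"] u[OF k(1)] by simp
    qed
    also have "\<dots> = prod u {..<?r}"
      using k by (simp add: prod.remove[of "{..<?r}" k])
    finally have "1 / prod u {..<?r} \<le> 1 / ?q ^ d"
      using q by (simp add: frac_le)
    also have "\<dots> \<le> e"
      using d e q by (simp add: field_simps)
    finally have "absv (1 / (\<Prod>i<?r. embed_A \<iota> (as ! i) ^ snd (ws ! i))) \<le> e"
      by (simp add: u_def absv_inverse absv_prod absv_power)
    then have "gauss_norm (tate_const (1 / (\<Prod>i<?r. embed_A \<iota> (as ! i) ^ snd (ws ! i)))) \<le> e"
      by (rule order_trans[OF gauss_norm_const])
    moreover have "gauss_norm (\<Prod>i<?r. chi \<iota> (fst (ws ! i)) (as ! i)) \<le> (\<Prod>i<?r. 1)"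
      by (intro gauss_norm_prod_le gauss_norm_chi)
    ultimately show ?thesis
      using gauss_norm_mult_le by fastforce
  qed
  then show "\<exists>d. \<forall>as\<in>zeta_index ?r - zeta_index_below ?r d.
      gauss_norm ((\<Prod>i<?r. chi \<iota> (fst (ws ! i)) (as ! i)) *
        tate_const (1 / (\<Prod>i<?r. embed_A \<iota> (as ! i) ^ snd (ws ! i)))) \<le> e"
    by blast
qed

lemma zeta1_tendsto:
  assumes "s > 0"
  shows "(\<lambda>d. zeta1_below \<iota> d \<Sigma> s) \<longlonglongrightarrow> zeta \<iota> [(\<Sigma>, s)]"
proof -
  have "tate_const (1 / embed_A \<iota> a ^ s) = inv_A \<iota> a ^ s" for a
    by (simp add: inv_A_def power_one_over flip: tate_const_power)
  then show ?thesis
    using zeta_tendsto[of "[(\<Sigma>, s)]"] assms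
    by (simp add: zeta_index_below_1[simplified] sum.reindex inj_on_def zeta1_below_def zeta_term_def)
qed

lemma zeta2_tendsto:
  assumes "s > 0" "t > 0"
  shows "(\<lambda>d. zeta2_below \<iota> d \<Sigma> s \<Gamma> t) \<longlonglongrightarrow> zeta \<iota> [(\<Sigma>, s), (\<Gamma>, t)]"
proof -
  let ?ws = "[(\<Sigma>, s), (\<Gamma>, t)]"
  have inv: "tate_const (1 / (embed_A \<iota> a ^ s * embed_A \<iota> b ^ t)) = inv_A \<iota> a ^ s * inv_A \<iota> b ^ t" for a b
    by (simp add: inv_A_def flip: tate_const_power tate_const_mult) (simp add: power_one_over)
  have "(\<Sum>as\<in>zeta_index_below 2 d. (\<Prod>i<2. chi \<iota> (fst (?ws ! i)) (as ! i)) *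
     tate_const (1 / (\<Prod>i<2. embed_A \<iota> (as ! i) ^ snd (?ws ! i)))) = zeta2_below \<iota> d \<Sigma> s \<Gamma> t" for d
  proof -
    have "inj_on (\<lambda>(a, b). [a, b]) ((SIGMA a:monics d. monics (degree a)) :: ('a poly \<times> 'a poly) set)"
      by (auto simp: inj_on_def)
    then have "(\<Sum>as\<in>zeta_index_below 2 d. (\<Prod>i<2. chi \<iota> (fst (?ws ! i)) (as ! i)) *
         tate_const (1 / (\<Prod>i<2. embed_A \<iota> (as ! i) ^ snd (?ws ! i))))
        = (\<Sum>(a, b)\<in>(SIGMA a:monics d. monics (degree a)). zeta_term \<iota> \<Sigma> s a * zeta_term \<iota> \<Gamma> t b)"
      unfolding zeta_index_below_2
      by (simp add: sum.reindex case_prod_unfold numeral_2_eq_2 zeta_term_def inv mult_ac)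
    also have "\<dots> = zeta2_below \<iota> d \<Sigma> s \<Gamma> t"
      by (subst sum.Sigma[symmetric])
        (simp_all add: finite_monics zeta2_below_def sum_distrib_left)
    finally show ?thesis .
  qed
  moreover have "length ?ws = 2" by simp
  moreover have "\<And>i. i < length ?ws \<Longrightarrow> snd (?ws ! i) > 0"
    using assms by (auto simp: less_Suc_eq)
  ultimately show ?thesis
    using zeta_tendsto[of ?ws] by (simp only:)
qed


section \<open>The product formula for truncated zeta values\<close>

text \<open>A nonzero polynomial is a scalar times a monic one; collecting the scalars yields a power sum
  over the finite field.\<close>

lemma sum_nonzero_zeta_term:
  "(\<Sum>c | c \<noteq> 0 \<and> degree c < e. zeta_term \<iota> J j c)
    = (if [size J = j] (mod (CARD('a) - 1)) then -1 else 0) * (\<Sum>b\<in>monics e. zeta_term \<iota> J j b)"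
proof -
  have "(\<Sum>c | c \<noteq> 0 \<and> degree c < e. zeta_term \<iota> J j c)
      = (\<Sum>(l, b)\<in>(UNIV - {0}) \<times> monics e. zeta_term \<iota> J j (smult l b))"
    by (rule sum.reindex_bij_witness[of _ "\<lambda>(l, b). smult l b"
          "\<lambda>c. (lead_coeff c, smult (inverse (lead_coeff c)) c)"])
      (auto simp: monics_def)
  also have "\<dots> = (\<Sum>(l, b)\<in>(UNIV - {0}) \<times> monics e.
      tate_const (scalar \<iota> (l ^ size J * inverse l ^ j)) * zeta_term \<iota> J j b)"
    by (intro sum.cong) (auto intro!: zeta_term_smult)
  also have "\<dots> = tate_const (scalar \<iota> (\<Sum>l\<in>UNIV - {0}. l ^ size J * inverse l ^ j))
      * (\<Sum>b\<in>monics e. zeta_term \<iota> J j b)"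
    by (simp add: sum.cartesian_product[symmetric] sum_product scalar_sum tate_const_sum)
  also have "tate_const (scalar \<iota> (\<Sum>l\<in>UNIV - {0}. l ^ size J * inverse l ^ j))
      = (if [size J = j] (mod (CARD('a) - 1)) then -1 else 0)"
    by (simp add: sum_power_finite_field scalar_uminus tate_const_uminus)
  finally show ?thesis .
qed

text \<open>A quadruple is determined by \<open>J\<close> and \<open>j\<close>.\<close>

lemma sum_stuffle_index:
  assumes "\<Lambda> \<subseteq># \<Omega>"
  shows "(\<Sum>(I, J, i, j)\<in>stuffle_index \<Omega> \<Lambda> w. F I J i j)
    = (\<Sum>J | J \<subseteq># \<Lambda>. \<Sum>j\<in>{1..<w}. F (\<Omega> - J) J (w - j) j)"
proof -
  have "(\<Sum>(I, J, i, j)\<in>stuffle_index \<Omega> \<Lambda> w. F I J i j)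
      = (\<Sum>(J, j)\<in>{J. J \<subseteq># \<Lambda>} \<times> {1..<w}. F (\<Omega> - J) J (w - j) j)"
    by (rule sum.reindex_bij_witness[of _ "\<lambda>(J, j). (\<Omega> - J, J, w - j, j)" "\<lambda>(I, J, i, j). (J, j)"])
      (use assms in \<open>auto simp: stuffle_index_def intro: subset_mset.diff_add subset_mset.order_trans\<close>)
  then show ?thesis
    by (simp add: sum.cartesian_product)
qed

text \<open>The contribution of the poles at \<open>a = 0\<close> to the product of the terms at \<open>a\<close> and \<open>b\<close>, when \<open>b\<close>
  is regarded as \<open>a - c\<close>.\<close>

definition fraction_part where
  "fraction_part \<Sigma> s \<Gamma> t a b
    = chi \<iota> \<Sigma> a * chi \<iota> \<Gamma> b * principal_part (inv_A \<iota> a) (inv_A \<iota> (a - b)) s t"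

lemma zeta_term_mult_eq_fraction_parts:
  assumes "a \<noteq> 0" "b \<noteq> 0" "a \<noteq> b" "s > 0"
  shows "zeta_term \<iota> \<Sigma> s a * zeta_term \<iota> \<Gamma> t b
    = fraction_part \<Sigma> s \<Gamma> t a b + fraction_part \<Gamma> t \<Sigma> s b a"
proof -
  have "inv_A \<iota> (b - a) = - inv_A \<iota> (a - b)"
    using inv_A_uminus[of "a - b"] by simp
  then have "inv_A \<iota> a ^ s * inv_A \<iota> b ^ t = principal_part (inv_A \<iota> a) (inv_A \<iota> (a - b)) s t
      + principal_part (inv_A \<iota> b) (inv_A \<iota> (b - a)) t s"
    using partial_fraction[OF inv_A_mult[OF assms(1-3)]] assms(4) by simp
  moreover have "zeta_term \<iota> \<Sigma> s a * zeta_term \<iota> \<Gamma> t b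
      = chi \<iota> \<Sigma> a * chi \<iota> \<Gamma> b * (inv_A \<iota> a ^ s * inv_A \<iota> b ^ t)"
    by (simp add: zeta_term_def mult_ac)
  ultimately show ?thesis
    by (simp add: fraction_part_def algebra_simps)
qed

text \<open>Subtraction from a monic \<open>a\<close> exchanges the other monic polynomials of the same degree with the
  nonzero polynomials of smaller degree, since the leading terms cancel.\<close>

lemma sum_same_degree_diff:
  fixes a :: "'a poly"
  assumes a: "a \<in> monics d"
  shows "(\<Sum>b | b \<in> monics d \<and> (degree a = degree b \<and> a \<noteq> b). f b)
    = (\<Sum>c | c \<noteq> 0 \<and> degree c < degree a. f (a - c))"
proof (rule sum.reindex_bij_witness[of _ "\<lambda>c. a - c" "\<lambda>b. a - b"])
  fix b assume b: "b \<in> {b. b \<in> monics d \<and> (degree a = degree b \<and> a \<noteq> b)}"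
  then have "coeff (a - b) (degree a) = 0"
    using a by (simp add: monics_def)
  moreover have "a - b \<noteq> 0"
    using b by simp
  then have "lead_coeff (a - b) \<noteq> 0"
    unfolding leading_coeff_0_iff .
  ultimately have "degree (a - b) \<noteq> degree a"
    by metis
  moreover have "degree (a - b) \<le> degree a"
    using b by (simp add: degree_diff_le)
  ultimately show "a - b \<in> {c. c \<noteq> 0 \<and> degree c < degree a}"
    using b by simp
next
  fix c :: "'a poly" assume c: "c \<in> {c. c \<noteq> 0 \<and> degree c < degree a}"
  then have deg: "degree (a - c) = degree a"
    using degree_add_eq_left[of "- c" a] by simp
  then have "lead_coeff (a - c) = 1"
    using a c by (simp add: monics_def coeff_eq_0)
  then show "a - c \<in> {b. b \<in> monics d \<and> (degree a = degree b \<and> a \<noteq> b)}"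
    using a c deg by (simp add: monics_def)
qed auto

text \<open>With \<open>b = a - c\<close>, the binomial expansion of \<open>\<chi>\<^sub>\<Gamma>(a - c)\<close> and the principal part separate the
  variables \<open>a\<close> and \<open>c\<close>.  The sum over \<open>c\<close> then becomes a sum over monic polynomials of degree less
  than \<open>deg a\<close>, at the cost of a factor \<open>-1\<close> or \<open>0\<close> that completes the coefficient to
  \<^const>\<open>Delta\<close>.\<close>

lemma sum_same_degree_fraction_part:
  assumes "s > 0" "t > 0"
  shows "(\<Sum>a\<in>monics d. \<Sum>b | b \<in> monics d \<and> (degree a = degree b \<and> a \<noteq> b). fraction_part \<Sigma> s \<Gamma> t a b)
    = (\<Sum>(I, J, i, j) \<in> stuffle_index (\<Sigma> + \<Gamma>) \<Gamma> (s + t).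
         of_int (Delta CARD('a) \<Gamma> j J t) * zeta2_below \<iota> d I i J j)"
proof -
  let ?N = "\<lambda>e. {c :: 'a poly. c \<noteq> 0 \<and> degree c < e}"
  let ?Js = "{J. J \<subseteq># \<Gamma>}" and ?js = "{1..<s + t}"
  define C where "C = (\<lambda>J j. of_nat (mset_binomial \<Gamma> J) * (-1) ^ size J
      * ((-1) ^ t * of_nat ((j - 1) choose (t - 1))) :: 'c tate)"
  \<comment> \<open>The signs come from \<open>\<chi>\<^sub>J(- c)\<close>, from the principal part and from the power sum over \<open>F\<^sub>q\<close>.\<close>
  have C: "C J j * (if [size J = j] (mod (CARD('a) - 1)) then -1 else 0)
      = of_int (Delta CARD('a) \<Gamma> j J t)" for J j
    using assms(2) by (cases t) (simp_all add: C_def Delta_def power_add)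
  have expand: "fraction_part \<Sigma> s \<Gamma> t a (a - c) = (\<Sum>J\<in>?Js. \<Sum>j\<in>?js.
      C J j * zeta_term \<iota> (\<Sigma> + \<Gamma> - J) (s + t - j) a * zeta_term \<iota> J j c)" for a c
  proof -
    define A where "A = (\<lambda>J. of_nat (mset_binomial \<Gamma> J) * chi \<iota> (\<Gamma> - J) a
      * ((-1) ^ size J * chi \<iota> J c))"
    define B where "B = (\<lambda>j. (-1) ^ t * of_nat ((j - 1) choose (t - 1))
      * inv_A \<iota> a ^ (s + t - j) * inv_A \<iota> c ^ j)"
    have "fraction_part \<Sigma> s \<Gamma> t a (a - c) = chi \<iota> \<Sigma> a * (sum A ?Js * sum B ?js)"
      using assms
      by (simp only: fraction_part_def chi_diff principal_part_altdef A_def B_def mult.assoc) simp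
    also have "\<dots> = (\<Sum>J\<in>?Js. \<Sum>j\<in>?js. chi \<iota> \<Sigma> a * (A J * B j))"
      by (simp only: sum_product) (simp only: sum_distrib_left)
    also have "\<dots> = (\<Sum>J\<in>?Js. \<Sum>j\<in>?js.
        C J j * zeta_term \<iota> (\<Sigma> + \<Gamma> - J) (s + t - j) a * zeta_term \<iota> J j c)"
    proof -
      have "chi \<iota> (\<Sigma> + \<Gamma> - J) a = chi \<iota> \<Sigma> a * chi \<iota> (\<Gamma> - J) a" if "J \<subseteq># \<Gamma>" for J
        by (simp only: multiset_diff_union_assoc[OF that] chi_union)
      then show ?thesis
        by (intro sum.cong refl) (simp add: A_def B_def C_def zeta_term_def mult_ac)
    qed
    finally show ?thesis .
  qed
  have inner: "(\<Sum>c\<in>?N (degree a). fraction_part \<Sigma> s \<Gamma> t a (a - c)) = (\<Sum>J\<in>?Js. \<Sum>j\<in>?js.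
      of_int (Delta CARD('a) \<Gamma> j J t) * (zeta_term \<iota> (\<Sigma> + \<Gamma> - J) (s + t - j) a
        * (\<Sum>b\<in>monics (degree a). zeta_term \<iota> J j b)))" for a
  proof -
    have "(\<Sum>c\<in>?N (degree a). fraction_part \<Sigma> s \<Gamma> t a (a - c)) = (\<Sum>J\<in>?Js. \<Sum>j\<in>?js.
        \<Sum>c\<in>?N (degree a). C J j * zeta_term \<iota> (\<Sigma> + \<Gamma> - J) (s + t - j) a * zeta_term \<iota> J j c)"
      unfolding expand by (subst sum.swap) (rule sum.cong[OF refl], rule sum.swap)
    also have "\<dots> = (\<Sum>J\<in>?Js. \<Sum>j\<in>?js. C J j * (if [size J = j] (mod (CARD('a) - 1)) then -1 else 0)
        * (zeta_term \<iota> (\<Sigma> + \<Gamma> - J) (s + t - j) a * (\<Sum>b\<in>monics (degree a). zeta_term \<iota> J j b)))"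
      by (intro sum.cong refl)
        (simp only: sum_distrib_left[symmetric] sum_nonzero_zeta_term, simp only: mult_ac)
    finally show ?thesis
      unfolding C .
  qed
  have "(\<Sum>a\<in>monics d. \<Sum>b | b \<in> monics d \<and> (degree a = degree b \<and> a \<noteq> b). fraction_part \<Sigma> s \<Gamma> t a b)
      = (\<Sum>a\<in>monics d. \<Sum>c\<in>?N (degree a). fraction_part \<Sigma> s \<Gamma> t a (a - c))"
    by (intro sum.cong refl sum_same_degree_diff)
  also have "\<dots> = (\<Sum>J\<in>?Js. \<Sum>j\<in>?js. \<Sum>a\<in>monics d.
      of_int (Delta CARD('a) \<Gamma> j J t) * (zeta_term \<iota> (\<Sigma> + \<Gamma> - J) (s + t - j) a
        * (\<Sum>b\<in>monics (degree a). zeta_term \<iota> J j b)))"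
    unfolding inner by (subst sum.swap) (rule sum.cong[OF refl], rule sum.swap)
  also have "\<dots> = (\<Sum>(I, J, i, j) \<in> stuffle_index (\<Sigma> + \<Gamma>) \<Gamma> (s + t).
         of_int (Delta CARD('a) \<Gamma> j J t) * zeta2_below \<iota> d I i J j)"
    by (subst sum_stuffle_index) (simp_all add: zeta2_below_def sum_distrib_left)
  finally show ?thesis .
qed

text \<open>The pairs of monic polynomials are split according to the comparison of their degrees, and
  those of equal degree into equal and distinct ones.  The condition on distinct pairs of equal
  degree is symmetric, so the two fraction parts can be summed separately and by the same lemma.\<close>

lemma zeta1_below_mult:
  assumes "s > 0" "t > 0"
  shows "zeta1_below \<iota> d \<Sigma> s * zeta1_below \<iota> d \<Gamma> t =
      zeta2_below \<iota> d \<Sigma> s \<Gamma> t + zeta2_below \<iota> d \<Gamma> t \<Sigma> s + zeta1_below \<iota> d (\<Sigma> + \<Gamma>) (s + t)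
      + (\<Sum>(I, J, i, j) \<in> stuffle_index (\<Sigma> + \<Gamma>) \<Gamma> (s + t).
           of_int (Delta CARD('a) \<Gamma> j J t) * zeta2_below \<iota> d I i J j)
      + (\<Sum>(I, J, i, j) \<in> stuffle_index (\<Sigma> + \<Gamma>) \<Sigma> (s + t).
           of_int (Delta CARD('a) \<Sigma> j J s) * zeta2_below \<iota> d I i J j)"
proof -
  let ?M = "monics d :: 'a poly set"
  define T where "T = (\<lambda>a b. zeta_term \<iota> \<Sigma> s a * zeta_term \<iota> \<Gamma> t b)"
  let ?E = "\<lambda>a. {b. b \<in> ?M \<and> (degree a = degree b \<and> a \<noteq> b)}"
  have below: "{b. b \<in> ?M \<and> degree b < degree a} = monics (degree a)" if "a \<in> ?M" for a
    using that by (auto simp: monics_def)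
  have split: "(\<Sum>b\<in>?M. T a b) = (\<Sum>b\<in>monics (degree a). T a b)
      + (\<Sum>b | b \<in> ?M \<and> degree a < degree b. T a b) + T a a + (\<Sum>b\<in>?E a. T a b)"
    if a: "a \<in> ?M" for a
  proof -
    have "?M = (({b. b \<in> ?M \<and> degree b < degree a} \<union> {b. b \<in> ?M \<and> degree a < degree b}) \<union> {a}) \<union> ?E a"
      using a by auto
    then have "(\<Sum>b\<in>?M. T a b) = (\<Sum>b\<in>(({b. b \<in> ?M \<and> degree b < degree a}
        \<union> {b. b \<in> ?M \<and> degree a < degree b}) \<union> {a}) \<union> ?E a. T a b)"
      by (rule arg_cong)
    also have "\<dots> = (\<Sum>b | b \<in> ?M \<and> degree b < degree a. T a b)
      + (\<Sum>b | b \<in> ?M \<and> degree a < degree b. T a b) + T a a + (\<Sum>b\<in>?E a. T a b)"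
      using finite_monics[of d, where 'a = 'a]
      by (subst sum.union_disjoint, force, force, force)+ simp
    finally show ?thesis
      unfolding below[OF a] .
  qed
  have "zeta1_below \<iota> d \<Sigma> s * zeta1_below \<iota> d \<Gamma> t = (\<Sum>a\<in>?M. \<Sum>b\<in>?M. T a b)"
    by (simp add: zeta1_below_def sum_product T_def)
  also have "\<dots> = (\<Sum>a\<in>?M. \<Sum>b\<in>monics (degree a). T a b)
      + (\<Sum>a\<in>?M. \<Sum>b | b \<in> ?M \<and> degree a < degree b. T a b)
      + (\<Sum>a\<in>?M. T a a) + (\<Sum>a\<in>?M. \<Sum>b\<in>?E a. T a b)"
    by (simp add: split sum.distrib)
  also have "(\<Sum>a\<in>?M. \<Sum>b\<in>monics (degree a). T a b) = zeta2_below \<iota> d \<Sigma> s \<Gamma> t"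
    by (simp add: zeta2_below_def sum_distrib_left T_def)
  also have "(\<Sum>a\<in>?M. \<Sum>b | b \<in> ?M \<and> degree a < degree b. T a b) = zeta2_below \<iota> d \<Gamma> t \<Sigma> s"
    by (subst sum.swap_restrict)
      (simp_all add: finite_monics below zeta2_below_def sum_distrib_left T_def mult.commute)
  also have "(\<Sum>a\<in>?M. T a a) = zeta1_below \<iota> d (\<Sigma> + \<Gamma>) (s + t)"
    by (simp add: zeta1_below_def T_def zeta_term_def chi_union power_add mult_ac)
  also have "(\<Sum>a\<in>?M. \<Sum>b\<in>?E a. T a b)
      = (\<Sum>a\<in>?M. \<Sum>b\<in>?E a. fraction_part \<Sigma> s \<Gamma> t a b + fraction_part \<Gamma> t \<Sigma> s b a)"
    unfolding T_def using assms
    by (intro sum.cong refl zeta_term_mult_eq_fraction_parts) (auto dest: monics_nonzero)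
  also have "\<dots> = (\<Sum>a\<in>?M. \<Sum>b\<in>?E a. fraction_part \<Sigma> s \<Gamma> t a b)
      + (\<Sum>a\<in>?M. \<Sum>b\<in>?E a. fraction_part \<Gamma> t \<Sigma> s b a)"
    by (simp add: sum.distrib)
  also have "(\<Sum>a\<in>?M. \<Sum>b\<in>?E a. fraction_part \<Gamma> t \<Sigma> s b a)
      = (\<Sum>b\<in>?M. \<Sum>a\<in>?E b. fraction_part \<Gamma> t \<Sigma> s b a)"
    by (subst sum.swap_restrict) (auto simp: finite_monics intro!: sum.cong)
  finally show ?thesis
    using sum_same_degree_fraction_part[OF assms, of \<Sigma> \<Gamma> d]
      sum_same_degree_fraction_part[OF assms(2,1), of \<Gamma> \<Sigma> d]
    by (simp add: add.assoc add.commute[of t s] add.commute[of \<Gamma> \<Sigma>])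
qed

end


section \<open>The product formula for zeta values\<close>

theorem theorem1p7:
  fixes \<iota> :: "'a::{finite,field} fls \<Rightarrow> 'c::{nonarch_field,complete_space}"
    and \<Sigma> \<Gamma> :: "nat multiset" and s t :: nat
  assumes "C_infty \<iota>"
    and "weighted_subset \<Sigma>" and "weighted_subset \<Gamma>"
    and "s > 0" and "t > 0"
  shows "zeta \<iota> [(\<Sigma>, s)] * zeta \<iota> [(\<Gamma>, t)] =
      zeta \<iota> [(\<Sigma>, s), (\<Gamma>, t)] + zeta \<iota> [(\<Gamma>, t), (\<Sigma>, s)] + zeta \<iota> [(\<Sigma> + \<Gamma>, s + t)]
      + (\<Sum>(I, J, i, j) \<in> stuffle_index (\<Sigma> + \<Gamma>) \<Gamma> (s + t).
           of_int (Delta CARD('a) \<Gamma> j J t) * zeta \<iota> [(I, i), (J, j)])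
      + (\<Sum>(I, J, i, j) \<in> stuffle_index (\<Sigma> + \<Gamma>) \<Sigma> (s + t).
           of_int (Delta CARD('a) \<Sigma> j J s) * zeta \<iota> [(I, i), (J, j)])"
proof -
  interpret C_infty \<iota> by fact
  have corr: "(\<lambda>d. \<Sum>(I, J, i, j) \<in> stuffle_index \<Omega> \<Lambda> w. of_int (D J j) * zeta2_below \<iota> d I i J j)
      \<longlonglongrightarrow> (\<Sum>(I, J, i, j) \<in> stuffle_index \<Omega> \<Lambda> w. of_int (D J j) * zeta \<iota> [(I, i), (J, j)])"
    for \<Omega> \<Lambda> w and D :: "nat multiset \<Rightarrow> nat \<Rightarrow> int"
    unfolding case_prod_unfold
    by (intro tendsto_sum tendsto_mult tendsto_const zeta2_tendsto) (auto simp: stuffle_index_def)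
  have "(\<lambda>d. zeta1_below \<iota> d \<Sigma> s * zeta1_below \<iota> d \<Gamma> t) \<longlonglongrightarrow> zeta \<iota> [(\<Sigma>, s)] * zeta \<iota> [(\<Gamma>, t)]"
    using assms by (intro tendsto_mult zeta1_tendsto)
  then show ?thesis
    unfolding zeta1_below_mult[OF assms(4,5)]
    by (rule LIMSEQ_unique) (use assms in \<open>intro tendsto_add corr zeta1_tendsto zeta2_tendsto; simp\<close>)
qed

end
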